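(* Let $\mathbf S$ be a general surface, i.e. a surface $y=y(x,u)$ with $S(2,0)=\mathbb{C}P_5$. Every spatial system of curves on $\mathbf S$ is represented by an equation $$u''=A+Bu'+Cu'^2+Du'^3,\qquad u'=\frac{du}{dx},\ u''=\frac{d^2u}{dx^2},$$ with $A,B,C,D$ functions of $(x,u)$; and conversely, every equation of this type represents a spatial system. Thus the spatial systems give the geometric interpretation of every equation of this type on a surface with $S(2,0)=\mathbb{C}P_5$.
   Context: Everything is local and complex analytic. A surface $\mathbf S\subset\mathbb{C}P_n$ is given by a vector of homogeneous coordinates $y=y(x,u)$. The embedded tangent plane $\Pi_P$ at $P=y$ is the projective plane spanned by $y,y_x,y_u$. $S(2,0)$ at $P$ is the projective span of $y,y_x,y_u,y_{xx},y_{xu},y_{uu}$ (second osculating space); $S(2,0)=\mathbb{C}P_5$ means these six vectors are linearly independent. The osculating plane of a curve at $P$ is the plane spanned by $y,y',y''$, derivatives being taken along the curve. The equation may also be written in unparametrized form as $dx\,d^2u-du\,d^2x=A\,dx^3+B\,dx^2du+C\,dx\,du^2+D\,du^3$. Spatial system: let $\{\Omega_P\}_{P\in\mathbf S}$ be a congruence of three-dimensional projective spaces, i.e. to each $P\in\mathbf S$ is attached (analytically) a space $\Omega_P\cong\mathbb{C}P_3$ in $S(2,0)=\mathbb{C}P_5$ at $P$, passing through $P$ and intersecting $\Pi_P$ only at $P$. A $2$-parameter system of curves on $\mathbf S$ (one curve through each point with each tangent direction) is called a spatial system if, for some such congruence, at each point $P$ the osculating planes at $P$ of the curves of the system through $P$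 intersect $\Omega_P$ in a line. *)

theory Defs
  imports "HOL-Analysis.Analysis"
begin

text \<open>
  The projective space of dimension \<open>n\<close> is the set of lines of \<open>complex ^ 'n\<close> with
  \<open>CARD('n) = n + 1\<close>; its projective subspaces are represented by the linear subspaces
  of \<open>complex ^ 'n\<close> lying over them.  The parameter pair \<open>(x, u)\<close> of a surface ranges
  over an open set \<open>U\<close>, and a point \<open>P\<close> of the surface is named by its parameters.
\<close>

definition proj_space :: "nat \<Rightarrow> (complex ^ 'n) set \<Rightarrow> bool" where
  "proj_space k V \<longleftrightarrow> vec.subspace V \<and> vec.dim V = k + 1"

definition holo2_on :: "(complex \<times> complex \<Rightarrow> complex) \<Rightarrow> (complex \<times> complex) set \<Rightarrow> bool" where
  "holo2_on f U \<longleftrightarrow>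
     (\<forall>p\<in>U. \<exists>a b. (f has_derivative (\<lambda>h. a * fst h + b * snd h)) (at p))"

definition vholo2_on :: "(complex \<times> complex \<Rightarrow> complex ^ 'n) \<Rightarrow> (complex \<times> complex) set \<Rightarrow> bool" where
  "vholo2_on f U \<longleftrightarrow> (\<forall>i. holo2_on (\<lambda>p. f p $ i) U)"

definition vderiv :: "(complex \<Rightarrow> complex ^ 'n) \<Rightarrow> complex \<Rightarrow> complex ^ 'n" where
  "vderiv f t = (\<chi> i. deriv (\<lambda>s. f s $ i) t)"

definition pdx :: "(complex \<times> complex \<Rightarrow> complex ^ 'n) \<Rightarrow> complex \<times> complex \<Rightarrow> complex ^ 'n" where
  "pdx f p = vderiv (\<lambda>x. f (x, snd p)) (fst p)"

definition pdu :: "(complex \<times> complex \<Rightarrow> complex ^ 'n) \<Rightarrow> complex \<times> complex \<Rightarrow> complex ^ 'n" where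
  "pdu f p = vderiv (\<lambda>u. f (fst p, u)) (snd p)"


subsection \<open>Surfaces\<close>

definition tangent_plane ::
    "(complex \<times> complex \<Rightarrow> complex ^ 'n) \<Rightarrow> complex \<times> complex \<Rightarrow> (complex ^ 'n) set" where
  "tangent_plane y p = vec.span {y p, pdx y p, pdu y p}"

definition osc2_list ::
    "(complex \<times> complex \<Rightarrow> complex ^ 'n) \<Rightarrow> complex \<times> complex \<Rightarrow> (complex ^ 'n) list" where
  "osc2_list y p =
     [y p, pdx y p, pdu y p, pdx (pdx y) p, pdu (pdx y) p, pdu (pdu y) p]"

text \<open>The second osculating space \<open>S(2,0)\<close>.\<close>

definition osc2_space ::
    "(complex \<times> complex \<Rightarrow> complex ^ 'n) \<Rightarrow> complex \<times> complex \<Rightarrow> (complex ^ 'n) set" where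
  "osc2_space y p = vec.span (set (osc2_list y p))"

text \<open>
  Distinctness is needed because \<open>vec.independent\<close> speaks about a set: it would not
  notice two equal vectors in the list.
\<close>

definition general_surface ::
    "(complex \<times> complex \<Rightarrow> complex ^ 'n) \<Rightarrow> (complex \<times> complex) set \<Rightarrow> bool" where
  "general_surface y U \<longleftrightarrow> vholo2_on y U \<and>
     (\<forall>p\<in>U. distinct (osc2_list y p) \<and> vec.independent (set (osc2_list y p)))"


subsection \<open>Curves and systems of curves\<close>

text \<open>
  A curve on the surface is given by a regular holomorphic parametrization \<open>\<gamma>\<close>,
  defined on a region \<open>T\<close>, of the corresponding curve in the parameter domain \<open>U\<close>.
\<close>

definition velocity :: "(complex \<Rightarrow> complex \<times> complex) \<Rightarrow> complex \<Rightarrow> complex \<times> complex" where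
  "velocity \<gamma> t = (deriv (\<lambda>s. fst (\<gamma> s)) t, deriv (\<lambda>s. snd (\<gamma> s)) t)"

definition curve_on ::
    "(complex \<times> complex) set \<Rightarrow> complex set \<Rightarrow> (complex \<Rightarrow> complex \<times> complex) \<Rightarrow> bool" where
  "curve_on U T \<gamma> \<longleftrightarrow> open T \<and> connected T \<and> T \<noteq> {} \<and>
     (\<lambda>t. fst (\<gamma> t)) holomorphic_on T \<and> (\<lambda>t. snd (\<gamma> t)) holomorphic_on T \<and>
     (\<forall>t\<in>T. \<gamma> t \<in> U \<and> velocity \<gamma> t \<noteq> (0, 0))"

definition osc_plane ::
    "(complex \<times> complex \<Rightarrow> complex ^ 'n) \<Rightarrow> (complex \<Rightarrow> complex \<times> complex) \<Rightarrow> complex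
      \<Rightarrow> (complex ^ 'n) set" where
  "osc_plane y \<gamma> t =
     vec.span {y (\<gamma> t), vderiv (\<lambda>s. y (\<gamma> s)) t, vderiv (vderiv (\<lambda>s. y (\<gamma> s))) t}"

definition same_direction :: "complex \<times> complex \<Rightarrow> complex \<times> complex \<Rightarrow> bool" where
  "same_direction d e \<longleftrightarrow> (\<exists>c. c \<noteq> 0 \<and> e = (c * fst d, c * snd d))"

text \<open>
  \<open>\<gamma>1\<close> near \<open>t1\<close> and \<open>\<gamma>2\<close> near \<open>t2\<close> are the same unparametrized curve germ.  For regular
  parametrizations the derivative of \<open>\<phi>\<close> at \<open>t1\<close> is automatically nonzero, so \<open>\<phi>\<close> is a
  local change of parameter.
\<close>

definition same_germ ::
    "(complex \<Rightarrow> complex \<times> complex) \<Rightarrow> complex \<Rightarrow>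
     (complex \<Rightarrow> complex \<times> complex) \<Rightarrow> complex \<Rightarrow> bool" where
  "same_germ \<gamma>1 t1 \<gamma>2 t2 \<longleftrightarrow>
     (\<exists>\<phi>. \<phi> analytic_on {t1} \<and> \<phi> t1 = t2 \<and> (\<forall>\<^sub>F t in nhds t1. \<gamma>1 t = \<gamma>2 (\<phi> t)))"

text \<open>
  A system of curves is a set of pairs \<open>(T, \<gamma>)\<close>.  It is a two-parameter system if
  exactly one curve germ passes through each point in each tangent direction,
  including the direction \<open>dx = 0\<close>.
\<close>

definition two_param_system ::
    "(complex \<times> complex) set \<Rightarrow> (complex set \<times> (complex \<Rightarrow> complex \<times> complex)) set \<Rightarrow> bool" where
  "two_param_system U \<Gamma> \<longleftrightarrow>
     (\<forall>(T, \<gamma>)\<in>\<Gamma>. curve_on U T \<gamma>) \<and>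
     (\<forall>p\<in>U. \<forall>d. d \<noteq> (0, 0) \<longrightarrow>
        (\<exists>(T, \<gamma>)\<in>\<Gamma>. \<exists>t\<in>T. \<gamma> t = p \<and> same_direction d (velocity \<gamma> t))) \<and>
     (\<forall>(T1, \<gamma>1)\<in>\<Gamma>. \<forall>(T2, \<gamma>2)\<in>\<Gamma>. \<forall>t1\<in>T1. \<forall>t2\<in>T2.
        \<gamma>1 t1 = \<gamma>2 t2 \<longrightarrow> same_direction (velocity \<gamma>1 t1) (velocity \<gamma>2 t2) \<longrightarrow>
        same_germ \<gamma>1 t1 \<gamma>2 t2)"


subsection \<open>Spatial systems\<close>

text \<open>
  The last clause says that \<open>\<Omega>\<close> is attached analytically: locally it has a
  holomorphic frame.
\<close>

definition space_congruence ::
    "(complex \<times> complex \<Rightarrow> complex ^ 'n) \<Rightarrow> (complex \<times> complex) set \<Rightarrow>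
     (complex \<times> complex \<Rightarrow> (complex ^ 'n) set) \<Rightarrow> bool" where
  "space_congruence y U \<Omega> \<longleftrightarrow>
     (\<forall>p\<in>U. proj_space 3 (\<Omega> p) \<and> \<Omega> p \<subseteq> osc2_space y p \<and>
        y p \<in> \<Omega> p \<and> \<Omega> p \<inter> tangent_plane y p = vec.span {y p}) \<and>
     (\<forall>p\<in>U. \<exists>V w. open V \<and> p \<in> V \<and> V \<subseteq> U \<and> (\<forall>k<4. vholo2_on (w k) V) \<and>
        (\<forall>q\<in>V. \<Omega> q = vec.span ((\<lambda>k::nat. w k q) ` {..<4})))"

definition spatial_system ::
    "(complex \<times> complex \<Rightarrow> complex ^ 'n) \<Rightarrow> (complex \<times> complex) set \<Rightarrow>
     (complex set \<times> (complex \<Rightarrow> complex \<times> complex)) set \<Rightarrow> bool" where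
  "spatial_system y U \<Gamma> \<longleftrightarrow> two_param_system U \<Gamma> \<and>
     (\<exists>\<Omega>. space_congruence y U \<Omega> \<and>
        (\<forall>(T, \<gamma>)\<in>\<Gamma>. \<forall>t\<in>T. proj_space 1 (osc_plane y \<gamma> t \<inter> \<Omega> (\<gamma> t))))"


subsection \<open>The differential equation\<close>

text \<open>
  The equation \<open>u'' = A + B u' + C u'^2 + D u'^3\<close> in the unparametrized form
  \<open>dx d^2u - du d^2x = A dx^3 + B dx^2 du + C dx du^2 + D du^3\<close>, which also makes sense
  for the curves tangent to \<open>dx = 0\<close>; \<open>integral_curve_graph\<close> recovers the first form.
\<close>

definition integral_curve ::
    "(complex \<times> complex \<Rightarrow> complex) \<Rightarrow> (complex \<times> complex \<Rightarrow> complex) \<Rightarrow>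
     (complex \<times> complex \<Rightarrow> complex) \<Rightarrow> (complex \<times> complex \<Rightarrow> complex) \<Rightarrow>
     complex set \<Rightarrow> (complex \<Rightarrow> complex \<times> complex) \<Rightarrow> bool" where
  "integral_curve A B C D T \<gamma> \<longleftrightarrow> (\<forall>t\<in>T.
     let dx = fst (velocity \<gamma> t); du = snd (velocity \<gamma> t);
         ddx = deriv (\<lambda>s. fst (velocity \<gamma> s)) t; ddu = deriv (\<lambda>s. snd (velocity \<gamma> s)) t
     in dx * ddu - du * ddx =
          A (\<gamma> t) * dx ^ 3 + B (\<gamma> t) * dx ^ 2 * du + C (\<gamma> t) * dx * du ^ 2 + D (\<gamma> t) * du ^ 3)"

lemma integral_curve_graph:
  "integral_curve A B C D T (\<lambda>x. (x, f x)) \<longleftrightarrow>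
     (\<forall>x\<in>T. deriv (deriv f) x =
        A (x, f x) + B (x, f x) * deriv f x + C (x, f x) * deriv f x ^ 2
          + D (x, f x) * deriv f x ^ 3)"
  by (simp add: integral_curve_def velocity_def Let_def)

text \<open>
  The equation represents the system \<open>\<Gamma>\<close> if its integral curves are exactly the curves
  which, up to the choice of parameter, locally belong to \<open>\<Gamma>\<close>.
\<close>

definition represents ::
    "(complex \<times> complex) set \<Rightarrow>
     (complex \<times> complex \<Rightarrow> complex) \<Rightarrow> (complex \<times> complex \<Rightarrow> complex) \<Rightarrow>
     (complex \<times> complex \<Rightarrow> complex) \<Rightarrow> (complex \<times> complex \<Rightarrow> complex) \<Rightarrow>
     (complex set \<times> (complex \<Rightarrow> complex \<times> complex)) set \<Rightarrow> bool" where
  "represents U A B C D \<Gamma> \<longleftrightarrow>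
     (\<forall>T \<gamma>. curve_on U T \<gamma> \<longrightarrow>
        (integral_curve A B C D T \<gamma> \<longleftrightarrow>
         (\<forall>t\<in>T. \<exists>(T', \<gamma>')\<in>\<Gamma>. \<exists>t'\<in>T'. same_germ \<gamma> t \<gamma>' t')))"

end

theory Submission
  imports Defs "HOL-Complex_Analysis.Complex_Analysis"
begin

text \<open>
  A three-space \<open>\<Omega>\<close> through \<open>y\<close> that meets the tangent plane only in \<open>y\<close> is the span of \<open>y\<close> and three
  points \<open>y\<^sub>x\<^sub>x + p\<^sub>1 y\<^sub>x + q\<^sub>1 y\<^sub>u\<close>, \<open>y\<^sub>x\<^sub>u + p\<^sub>2 y\<^sub>x + q\<^sub>2 y\<^sub>u\<close>, \<open>y\<^sub>u\<^sub>u + p\<^sub>3 y\<^sub>x + q\<^sub>3 y\<^sub>u\<close>, with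
  uniquely determined, hence holomorphic, coefficients.  Reducing the second derivative of \<open>y\<close> along a
  curve modulo \<open>\<Omega>\<close> leaves a vector of the plane \<open>\<langle>y\<^sub>x, y\<^sub>u\<rangle>\<close>, and the osculating plane meets \<open>\<Omega>\<close> in a line
  exactly if that vector is proportional to the velocity.  This is the equation with \<open>A = q\<^sub>1\<close>,
  \<open>B = 2 q\<^sub>2 - p\<^sub>1\<close>, \<open>C = q\<^sub>3 - 2 p\<^sub>2\<close>, \<open>D = - p\<^sub>3\<close>, and every \<open>A\<close>, \<open>B\<close>, \<open>C\<close>, \<open>D\<close> arises, for instance with
  \<open>p\<^sub>1 = p\<^sub>2 = 0\<close>.  Existence and uniqueness for the holomorphic differential equation then identify the
  system with its integral curves.
\<close>

subsection \<open>Holomorphic functions of two variables\<close>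

text \<open>\<open>holo2_on\<close> grants only a complex linear derivative at each point. The
  osculating data need second partial derivatives that are again holomorphic, and a symmetric mixed
  one; Cauchy's estimate provides both. The cubic arises because modulo \<Omega> the second
  derivative of \<open>y\<close> along a curve is \<open>(x'' - P) y_x + (u'' - Q) y_u\<close> with
  quadratic forms \<open>P\<close>, \<open>Q\<close> in \<open>(x', u')\<close>. Being parallel to
  the velocity is the vanishing of a determinant, to which \<open>P\<close> and \<open>Q\<close>
  contribute \<open>x' Q - u' P\<close>. Adding \<open>l x'\<close> to \<open>P\<close> and
  \<open>l u'\<close> to \<open>Q\<close>, with \<open>l\<close> a linear form, leaves this cubic
  unchanged: hence six coefficients give only four, and \<open>p1 = p2 = 0\<close> is a mere
  normalisation. Two obstacles remain. \<Omega> comes with an arbitrary local frame, so holomorphy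
  of its coefficients has to be extracted by linear algebra, in an ambient space whose dimension may
  exceed six. And graphs \<open>u = f(x)\<close> miss the direction \<open>dx = 0\<close>, which is
  reached by exchanging \<open>x\<close> and \<open>u\<close>.\<close>

definition px :: "(complex \<times> complex \<Rightarrow> complex) \<Rightarrow> complex \<times> complex \<Rightarrow> complex" where
  "px f p = deriv (\<lambda>x. f (x, snd p)) (fst p)"

definition pu :: "(complex \<times> complex \<Rightarrow> complex) \<Rightarrow> complex \<times> complex \<Rightarrow> complex" where
  "pu f p = deriv (\<lambda>u. f (fst p, u)) (snd p)"

text \<open>The working form of holomorphy, in the sense of Osgood's lemma: on open sets it agrees
  with \<open>holo2_on\<close> (see \<open>holo2_eq_sep\<close>), and it passes to partial
  derivatives one variable at a time.\<close>

definition sep_holo_on :: "(complex \<times> complex \<Rightarrow> complex) \<Rightarrow> (complex \<times> complex) set \<Rightarrow> bool" where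
  "sep_holo_on f U \<longleftrightarrow> continuous_on U f \<and>
     (\<forall>p\<in>U. (\<lambda>x. f (x, snd p)) field_differentiable at (fst p)) \<and>
     (\<forall>p\<in>U. (\<lambda>u. f (fst p, u)) field_differentiable at (snd p))"

lemma open_contains_bidisc:
  fixes U :: "(complex \<times> complex) set"
  assumes "open U" "p \<in> U"
  obtains r where "r > 0" "cball (fst p) r \<times> cball (snd p) r \<subseteq> U"
proof -
  obtain X Y where XY: "open X" "open Y" "p \<in> X \<times> Y" "X \<times> Y \<subseteq> U"
    using open_prod_elim[OF assms] by blast
  obtain r s where r: "r > 0" "cball (fst p) r \<subseteq> X" and s: "s > 0" "cball (snd p) s \<subseteq> Y"
    using XY open_contains_cball by (metis mem_Times_iff)
  show thesis
  proof (rule that[of "min r s"])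
    show "cball (fst p) (min r s) \<times> cball (snd p) (min r s) \<subseteq> U"
      using r s XY(4) by fastforce
  qed (use r s in auto)
qed

text \<open>Taylor's formula of first order, with the second derivative controlled by Cauchy's
  estimate. The bound does not depend on \<open>x\<close>, so the quotients converge uniformly. The
  radii leave room twice: \<open>x\<close> and \<open>x + h\<close> lie in the disc of radius
  \<open>2 * r\<close>, and a circle of radius \<open>r\<close> about any point there stays inside
  the disc of radius \<open>3 * r\<close>.\<close>

lemma difference_quotient_bound:
  fixes g :: "complex \<Rightarrow> complex"
  assumes g: "g holomorphic_on ball c (3 * r)" and M: "\<And>z. z \<in> ball c (3 * r) \<Longrightarrow> norm (g z) \<le> M"
    and r: "r > 0" and x: "x \<in> ball c r" and h: "h \<noteq> 0" "norm h < r"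
  shows "norm ((g (x + h) - g x) / h - deriv g x) \<le> 2 * M / r ^ 2 * norm h"
proof -
  let ?S = "ball c (2 * r)"
  have sub: "?S \<subseteq> ball c (3 * r)" using r by auto
  have "norm (g (x + h) - (\<Sum>i\<le>1. (deriv ^^ i) g x * ((x + h) - x) ^ i / fact i))
      \<le> (2 * M / r ^ 2) * norm ((x + h) - x) ^ Suc 1 / fact 1"
  proof (rule complex_Taylor[where f = "\<lambda>i. (deriv ^^ i) g" and S = ?S, simplified funpow_0])
    show "((deriv ^^ i) g has_field_derivative (deriv ^^ Suc i) g z) (at z within ?S)"
      if "z \<in> ?S" "i \<le> 1" for i z
    proof -
      have "(deriv ^^ i) g holomorphic_on ball c (3 * r)" using g by (intro holomorphic_higher_deriv) auto
      then have "((deriv ^^ i) g has_field_derivative deriv ((deriv ^^ i) g) z) (at z)"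
        using that sub by (intro holomorphic_derivI) auto
      then show ?thesis by (auto intro: has_field_derivative_at_within)
    qed
    show "norm ((deriv ^^ Suc 1) g z) \<le> 2 * M / r ^ 2" if "z \<in> ?S" for z
    proof -
      have zs: "cball z r \<subseteq> ball c (3 * r)"
      proof
        fix w assume "w \<in> cball z r"
        then show "w \<in> ball c (3 * r)" using that dist_triangle[of c w z] by auto
      qed
      have "norm ((deriv ^^ 2) g z) \<le> fact 2 * M / r ^ 2"
      proof (rule Cauchy_inequality)
        show "g holomorphic_on ball z r" using g zs by (meson ball_subset_cball holomorphic_on_subset order_trans)
        show "continuous_on (cball z r) g" using g zs by (meson holomorphic_on_imp_continuous_on holomorphic_on_subset)
        show "norm (g w) \<le> M" if "norm (z - w) = r" for w
          using that zs by (intro M) (auto simp: dist_norm subset_iff)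
      qed (use r in auto)
      then show ?thesis by (simp add: numeral_2_eq_2)
    qed
    show "x \<in> ?S" using x r by auto
    have "dist c (x + h) \<le> dist c x + norm h"
      using dist_triangle[of c "x + h" x] by (simp add: dist_norm)
    then show "x + h \<in> ?S" using x h by auto
  qed auto
  then have "norm (g (x + h) - g x - deriv g x * h) \<le> 2 * M / r ^ 2 * norm h * norm h"
    by (simp add: algebra_simps power2_eq_square)
  then have "norm (g (x + h) - g x - deriv g x * h) / norm h \<le> 2 * M / r ^ 2 * norm h"
    using h by (subst pos_divide_le_eq) (auto simp: mult.assoc)
  moreover have "(g (x + h) - g x) / h - deriv g x = (g (x + h) - g x - deriv g x * h) / h"
    using h by (simp add: field_simps)
  ultimately show ?thesis by (metis norm_divide)
qed

lemma sep_holo_onD: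
  assumes "sep_holo_on f U" "(x, u) \<in> U"
  shows "((\<lambda>x. f (x, u)) has_field_derivative px f (x, u)) (at x)"
    and "((\<lambda>u. f (x, u)) has_field_derivative pu f (x, u)) (at u)"
  using assms unfolding sep_holo_on_def px_def pu_def field_differentiable_derivI
  by (metis DERIV_deriv_iff_field_differentiable fst_conv snd_conv)+

text \<open>Locally \<open>\<partial>f/\<partial>x\<close> is a uniform limit of the difference quotients in \<open>x\<close>, so it inherits
  continuity and holomorphy in \<open>u\<close>.\<close>

lemma sep_holo_px_aux:
  assumes U: "open U" and f: "sep_holo_on f U" and p: "p \<in> U"
  shows "isCont (px f) p" and "(\<lambda>x. px f (x, snd p)) field_differentiable at (fst p)"
    and "(\<lambda>u. px f (fst p, u)) field_differentiable at (snd p)"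
    and "\<exists>h. (\<forall>n. h n \<noteq> 0) \<and> h \<longlonglongrightarrow> 0 \<and>
           (\<lambda>n. (pu f (fst p + h n, snd p) - pu f p) / h n) \<longlonglongrightarrow> pu (px f) p"
proof -
  obtain x0 u0 where p_eq: "p = (x0, u0)" by fastforce
  obtain R where R: "R > 0" "cball x0 R \<times> cball u0 R \<subseteq> U"
    using open_contains_bidisc[OF U p] p_eq by auto
  define r where "r = R / 3"
  have r: "r > 0" "3 * r = R" using R by (auto simp: r_def)
  let ?K = "cball x0 R \<times> cball u0 R"
  have cf: "continuous_on U f" using f by (simp add: sep_holo_on_def)
  have "bounded (f ` ?K)"
    by (intro compact_imp_bounded compact_continuous_image continuous_on_subset[OF cf R(2)] compact_Times) auto
  then obtain M where M: "\<And>z. z \<in> ?K \<Longrightarrow> norm (f z) \<le> M" by (auto simp: bounded_iff)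
  \<comment> \<open>Adding 2 keeps every step, also the one for \<open>n = 0\<close>, strictly below
    \<open>r\<close>.\<close>
  define h where "h n = complex_of_real (r / (real n + 2))" for n
  have hpos: "0 < r / (real n + 2)" "r / (real n + 2) < r" for n
    using r by (auto simp: divide_simps)
  have h0: "h n \<noteq> 0" and hr: "norm (h n) < r" for n
    using hpos[of n] unfolding h_def norm_of_real of_real_eq_0_iff by linarith+
  have hlim: "h \<longlonglongrightarrow> 0"
  proof -
    have "(\<lambda>n. r / (real n + 2)) \<longlonglongrightarrow> 0" by real_asymp
    then have "(\<lambda>n. complex_of_real (r / (real n + 2))) \<longlonglongrightarrow> of_real 0" by (rule tendsto_of_real)
    then show ?thesis unfolding h_def of_real_0 .
  qed
  define q where "q n z = (f (fst z + h n, snd z) - f z) / h n" for n z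
  \<comment> \<open>Only the disc for \<open>x\<close> is shrunk, to leave room for the shift by
    \<open>h n\<close>.\<close>
  let ?W = "ball x0 r \<times> ball u0 R"
  have WU: "?W \<subseteq> U" using R r by fastforce
  have shift: "(x + h n, u) \<in> U" if "x \<in> ball x0 r" "u \<in> ball u0 R" for x u n
  proof -
    have "norm (x0 - (x + h n)) \<le> norm (x0 - x) + norm (h n)"
      by (metis diff_diff_eq norm_triangle_ineq4)
    then have "dist x0 (x + h n) \<le> R" using that hr[of n] r by (auto simp: dist_norm)
    then show ?thesis using that R by auto
  qed
  have holx: "(\<lambda>x. f (x, u)) holomorphic_on ball x0 R" if "u \<in> ball u0 R" for u
  proof -
    have "(x, u) \<in> U" if "x \<in> ball x0 R" for x using that \<open>u \<in> ball u0 R\<close> R by auto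
    then show ?thesis
      using sep_holo_onD(1)[OF f] unfolding holomorphic_on_open[OF open_ball] by blast
  qed
  have bound: "dist (q n z) (px f z) \<le> 2 * M / r ^ 2 * norm (h n)" if "z \<in> ?W" for n z
  proof -
    have "norm ((f (fst z + h n, snd z) - f (fst z, snd z)) / h n - deriv (\<lambda>x. f (x, snd z)) (fst z))
        \<le> 2 * M / r ^ 2 * norm (h n)"
    proof (rule difference_quotient_bound[where c = x0 and g = "\<lambda>x. f (x, snd z)"])
      show "(\<lambda>x. f (x, snd z)) holomorphic_on ball x0 (3 * r)" using holx that r by auto
      show "norm (f (w, snd z)) \<le> M" if "w \<in> ball x0 (3 * r)" for w
        using that \<open>z \<in> ?W\<close> r by (intro M) (auto simp: mem_Times_iff less_imp_le)
    qed (use r h0 hr that in auto)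
    then show ?thesis by (simp add: dist_norm q_def px_def)
  qed
  have ul: "uniform_limit ?W q (px f) sequentially"
  proof (rule uniform_limitI)
    fix e :: real assume "e > 0"
    have "(\<lambda>n. 2 * M / r ^ 2 * norm (h n)) \<longlonglongrightarrow> 2 * M / r ^ 2 * norm (0::complex)"
      by (intro tendsto_intros hlim)
    then have "eventually (\<lambda>n. 2 * M / r ^ 2 * norm (h n) < e) sequentially"
      using \<open>e > 0\<close> by (intro order_tendstoD) auto
    then show "\<forall>\<^sub>F n in sequentially. \<forall>z\<in>?W. dist (q n z) (px f z) < e"
      by eventually_elim (use bound le_less_trans in blast)
  qed
  have cq: "continuous_on ?W (q n)" for n
    unfolding q_def
    by (intro continuous_intros continuous_on_compose2[OF cf] h0 continuous_on_subset[OF cf WU] ballI)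
       (auto simp: shift h0)
  have cont: "continuous_on ?W (px f)"
    by (rule uniform_limit_theorem[OF _ ul]) (simp_all add: cq)
  have oW: "open ?W" by (intro open_Times) auto
  have pW: "p \<in> ?W" using p_eq r R by auto
  show "isCont (px f) p" using cont oW pW continuous_on_eq_continuous_at by blast
  have "deriv (\<lambda>x. f (x, u0)) field_differentiable at x0"
    by (intro holomorphic_on_imp_differentiable_at[of _ "ball x0 R"] holomorphic_deriv holx) (use R in auto)
  then show "(\<lambda>x. px f (x, snd p)) field_differentiable at (fst p)"
    by (simp add: px_def p_eq)
  \<comment> \<open>Termwise differentiation in \<open>u\<close> of a locally uniform limit: the
    derivative of a quotient is a difference quotient in \<open>x\<close> of \<open>pu f\<close>.
    Its limit is kept, since it later gives the symmetry of the mixed derivatives.\<close>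
  have "\<exists>g'. \<forall>u\<in>ball u0 R. ((\<lambda>u. px f (x0, u)) has_field_derivative g' u) (at u) \<and>
     (\<lambda>n. (pu f (x0 + h n, u) - pu f (x0, u)) / h n) \<longlonglongrightarrow> g' u"
  proof (rule has_complex_derivative_uniform_sequence[where f = "\<lambda>n u. q n (x0, u)"])
    show "((\<lambda>u. q n (x0, u)) has_field_derivative (pu f (x0 + h n, u) - pu f (x0, u)) / h n) (at u)"
      if "u \<in> ball u0 R" for n u
      unfolding q_def fst_conv snd_conv
      by (intro derivative_intros DERIV_cdivide sep_holo_onD(2)[OF f] shift that) (use that WU r in auto)
    show "\<exists>d>0. cball u d \<subseteq> ball u0 R \<and> uniform_limit (cball u d) (\<lambda>n u. q n (x0, u)) (\<lambda>u. px f (x0, u)) sequentially"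
      if "u \<in> ball u0 R" for u
    proof -
      obtain d where d: "d > 0" "cball u d \<subseteq> ball u0 R" using \<open>u \<in> ball u0 R\<close> open_contains_cball[of "ball u0 R"] by (metis open_ball)
      moreover have "uniform_limit (cball u d) (\<lambda>n u. q n (x0, u)) (\<lambda>u. px f (x0, u)) sequentially"
      proof (rule uniform_limitI)
        fix e :: real assume "e > 0"
        have "(x0, v) \<in> ?W" if "v \<in> cball u d" for v using that d(2) r(1) by auto
        with uniform_limitD[OF ul \<open>e > 0\<close>]
        show "\<forall>\<^sub>F n in sequentially. \<forall>v\<in>cball u d. dist (q n (x0, v)) (px f (x0, v)) < e"
          by (auto elim!: eventually_mono)
      qed
      ultimately show ?thesis by blast
    qed
  qed auto
  then obtain g' where g': "((\<lambda>u. px f (x0, u)) has_field_derivative g') (at u0)"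
     "(\<lambda>n. (pu f (x0 + h n, u0) - pu f (x0, u0)) / h n) \<longlonglongrightarrow> g'"
    using R by fastforce
  show "(\<lambda>u. px f (fst p, u)) field_differentiable at (snd p)"
    using g' by (auto simp: p_eq field_differentiable_def)
  have "g' = pu (px f) p" using g'(1) by (auto simp: p_eq pu_def DERIV_imp_deriv)
  then show "\<exists>h. (\<forall>n. h n \<noteq> 0) \<and> h \<longlonglongrightarrow> 0 \<and>
           (\<lambda>n. (pu f (fst p + h n, snd p) - pu f p) / h n) \<longlonglongrightarrow> pu (px f) p"
    using h0 hlim g'(2) p_eq by auto
qed

lemma sep_holo_px: "open U \<Longrightarrow> sep_holo_on f U \<Longrightarrow> sep_holo_on (px f) U"
  using sep_holo_px_aux(1-3) by (simp add: sep_holo_on_def continuous_at_imp_continuous_on)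

section \<open>Exchange of the variables, and total differentiability\<close>

lemma open_swap: "open U \<Longrightarrow> open (prod.swap ` U)" for U :: "(complex \<times> complex) set"
proof -
  assume U: "open U"
  have "prod.swap ` U = prod.swap -` U" by force
  moreover have "open (prod.swap -` U)" using U
    by (intro open_vimage) (auto simp: prod.swap_def intro!: continuous_intros)
  ultimately show ?thesis by simp
qed

lemma sep_holo_swap: "sep_holo_on f U \<Longrightarrow> sep_holo_on (f \<circ> prod.swap) (prod.swap ` U)"
  unfolding sep_holo_on_def
  by (auto intro!: continuous_on_compose continuous_on_swap simp: image_image simp del: o_apply) auto

text \<open>Lets facts about \<open>pu\<close> be read off from those about \<open>px\<close> after
  exchanging the variables.\<close>

lemma pu_swap: "pu f = px (f \<circ> prod.swap) \<circ> prod.swap"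
  by (auto simp: pu_def px_def)

lemma sep_holo_pu:
  assumes "open U" "sep_holo_on f U"
  shows "sep_holo_on (pu f) U"
proof -
  have "sep_holo_on (px (f \<circ> prod.swap) \<circ> prod.swap) (prod.swap ` prod.swap ` U)"
    by (intro sep_holo_swap sep_holo_px open_swap assms)
  then show ?thesis by (simp add: pu_swap image_image)
qed

lemma holo2_imp_sep:
  assumes "holo2_on f U" shows "sep_holo_on f U"
proof -
  have d: "\<exists>a b. (f has_derivative (\<lambda>h. a * fst h + b * snd h)) (at (x, u))" if "(x, u) \<in> U" for x u
    using assms that by (auto simp: holo2_on_def)
  have "continuous_on U f"
    using d by (intro continuous_at_imp_continuous_on) (metis has_derivative_continuous surj_pair)
  moreover have "(\<lambda>x. f (x, u)) field_differentiable at x \<and> (\<lambda>u. f (x, u)) field_differentiable at u"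
    if xu: "(x, u) \<in> U" for x u
  proof -
    obtain a b where ab: "(f has_derivative (\<lambda>h. a * fst h + b * snd h)) (at (x, u))" using d[OF xu] by blast
    have "((\<lambda>x. f (x, u)) has_derivative (\<lambda>h. a * fst (h, 0::complex) + b * snd (h, 0::complex))) (at x)"
      by (rule has_derivative_compose[where f = "\<lambda>x. (x, u)", OF _ ab]) (auto intro!: derivative_eq_intros)
    moreover have "((\<lambda>u. f (x, u)) has_derivative (\<lambda>h. a * fst (0::complex, h) + b * snd (0::complex, h))) (at u)"
      by (rule has_derivative_compose[where f = "\<lambda>u. (x, u)", OF _ ab]) (auto intro!: derivative_eq_intros)
    ultimately show ?thesis
      by (auto simp: field_differentiable_def has_field_derivative_def)
  qed
  ultimately show ?thesis by (auto simp: sep_holo_on_def)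
qed

text \<open>Both partial derivatives exist and one of them, \<open>pu f\<close>, is continuous by
  \<open>sep_holo_pu\<close>; this suffices for a total derivative.\<close>

lemma sep_has_derivative:
  assumes U: "open U" and f: "sep_holo_on f U" and p: "p \<in> U"
  shows "(f has_derivative (\<lambda>h. px f p * fst h + pu f p * snd h)) (at p)"
proof -
  obtain x u where p_eq: "p = (x, u)" by fastforce
  obtain R where R: "R > 0" "cball x R \<times> cball u R \<subseteq> U"
    using open_contains_bidisc[OF U p] p_eq by auto
  let ?X = "ball x R" and ?Y = "ball u R"
  have W: "open (?X \<times> ?Y)" "p \<in> ?X \<times> ?Y" "?X \<times> ?Y \<subseteq> U" using R p_eq by (auto intro!: open_Times)
  have "((\<lambda>(x, u). f (x, u)) has_derivative
     (\<lambda>(tx, ty). (\<lambda>h. px f (x, u) * h) tx + blinfun_apply (blinfun_mult_right (pu f (x, u))) ty)) (at (x, u) within ?X \<times> ?Y)"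
  proof (rule has_derivative_partialsI)
    show "((\<lambda>x. f (x, u)) has_derivative (*) (px f (x, u))) (at x within ?X)"
      using sep_holo_onD(1)[OF f p[unfolded p_eq]]
      by (simp add: has_field_derivative_def has_derivative_at_withinI)
    show "((\<lambda>u. f (x, u)) has_derivative blinfun_apply (blinfun_mult_right (pu f (x, u)))) (at u within ?Y)"
      if "x \<in> ?X" "u \<in> ?Y" for x u
    proof -
      have "(x, u) \<in> U" using that W by auto
      from sep_holo_onD(2)[OF f this] show ?thesis
        by (simp add: has_field_derivative_def has_derivative_at_withinI)
    qed
    have "continuous_on U (pu f)" using sep_holo_pu[OF U f] by (simp add: sep_holo_on_def)
    then have "isCont (pu f) (x, u)" using U p p_eq continuous_on_eq_continuous_at by blast
    then have "isCont (\<lambda>z. blinfun_mult_right (pu f z)) (x, u)"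
      by (intro bounded_linear.continuous[OF bounded_linear_blinfun_mult_right])
    then show "continuous (at (x, u) within ?X \<times> ?Y) (\<lambda>(x, u). blinfun_mult_right (pu f (x, u)))"
      by (simp add: split_def continuous_at_imp_continuous_at_within)
  qed (use R in auto)
  then have "(f has_derivative (\<lambda>h. px f p * fst h + pu f p * snd h)) (at p within ?X \<times> ?Y)"
    by (simp add: split_def p_eq)
  then show ?thesis using at_within_open[OF W(2,1)] by simp
qed

lemma holo2_eq_sep: "open U \<Longrightarrow> holo2_on f U \<longleftrightarrow> sep_holo_on f U"
  using holo2_imp_sep sep_has_derivative unfolding holo2_on_def by blast

lemma holo2_px: "open U \<Longrightarrow> holo2_on f U \<Longrightarrow> holo2_on (px f) U"
  by (simp add: holo2_eq_sep sep_holo_px)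

lemma holo2_pu: "open U \<Longrightarrow> holo2_on f U \<Longrightarrow> holo2_on (pu f) U"
  by (simp add: holo2_eq_sep sep_holo_pu)

lemma holo2_swap: "open U \<Longrightarrow> holo2_on f U \<Longrightarrow> holo2_on (f \<circ> prod.swap) (prod.swap ` U)"
  by (simp add: holo2_eq_sep sep_holo_swap open_swap)

lemma holo2_has_derivative:
  "open U \<Longrightarrow> holo2_on f U \<Longrightarrow> p \<in> U \<Longrightarrow>
    (f has_derivative (\<lambda>h. px f p * fst h + pu f p * snd h)) (at p)"
  using sep_has_derivative holo2_imp_sep by blast

lemma holo2_continuous: "holo2_on f U \<Longrightarrow> continuous_on U f"
  using holo2_imp_sep sep_holo_on_def by blast

text \<open>The difference quotients of \<open>pu f\<close> in \<open>x\<close> tend to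
  \<open>px (pu f)\<close> by definition and, along a suitable null sequence, to
  \<open>pu (px f)\<close> by the uniform convergence in \<open>sep_holo_px_aux\<close>.\<close>

lemma pu_px_commute:
  assumes U: "open U" and f: "holo2_on f U" and p: "p \<in> U"
  shows "pu (px f) p = px (pu f) p"
proof -
  note s = holo2_imp_sep[OF f]
  obtain h where h: "\<And>n. h n \<noteq> (0::complex)" "h \<longlonglongrightarrow> 0"
    and lim: "(\<lambda>n. (pu f (fst p + h n, snd p) - pu f p) / h n) \<longlonglongrightarrow> pu (px f) p"
    using sep_holo_px_aux(4)[OF U s p] by blast
  have "((\<lambda>x. pu f (x, snd p)) has_field_derivative px (pu f) p) (at (fst p))"
    using sep_holo_onD(1)[OF sep_holo_pu[OF U s], of "fst p" "snd p"] p by simp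
  then have "((\<lambda>h. (pu f (fst p + h, snd p) - pu f p) / h) \<longlongrightarrow> px (pu f) p) (at 0)"
    by (simp add: DERIV_def)
  then have "(\<lambda>n. (pu f (fst p + h n, snd p) - pu f p) / h n) \<longlonglongrightarrow> px (pu f) p"
    by (rule filterlim_compose) (use h in \<open>auto simp: filterlim_at\<close>)
  with lim show ?thesis using LIMSEQ_unique by blast
qed

section \<open>Closure properties of holomorphic functions of two variables\<close>

lemma holo2_subset: "holo2_on f U \<Longrightarrow> V \<subseteq> U \<Longrightarrow> holo2_on f V"
  by (auto simp: holo2_on_def)

lemma holo2_const: "holo2_on (\<lambda>_. c) U"
  by (auto simp: holo2_on_def intro!: exI[of _ 0])

lemma holo2_add: "holo2_on f U \<Longrightarrow> holo2_on g U \<Longrightarrow> holo2_on (\<lambda>p. f p + g p) U"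
  unfolding holo2_on_def
proof (intro ballI, elim ballE exE)
  fix p a b c d
  assume "(f has_derivative (\<lambda>h. a * fst h + b * snd h)) (at p)"
    "(g has_derivative (\<lambda>h. c * fst h + d * snd h)) (at p)"
  from has_derivative_add[OF this]
  show "\<exists>a b. ((\<lambda>p. f p + g p) has_derivative (\<lambda>h. a * fst h + b * snd h)) (at p)"
    by (intro exI[of _ "a + c"] exI[of _ "b + d"]) (simp add: algebra_simps)
qed auto

lemma holo2_mult: "holo2_on f U \<Longrightarrow> holo2_on g U \<Longrightarrow> holo2_on (\<lambda>p. f p * g p) U"
  unfolding holo2_on_def
proof (intro ballI, elim ballE exE)
  fix p a b c d
  assume "(f has_derivative (\<lambda>h. a * fst h + b * snd h)) (at p)"
    "(g has_derivative (\<lambda>h. c * fst h + d * snd h)) (at p)"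
  from has_derivative_mult[OF this]
  show "\<exists>a b. ((\<lambda>p. f p * g p) has_derivative (\<lambda>h. a * fst h + b * snd h)) (at p)"
    by (intro exI[of _ "f p * c + a * g p"] exI[of _ "f p * d + b * g p"]) (simp add: algebra_simps)
qed auto

lemma holo2_inverse:
  assumes "holo2_on f U" "\<And>p. p \<in> U \<Longrightarrow> f p \<noteq> 0"
  shows "holo2_on (\<lambda>p. inverse (f p)) U"
  unfolding holo2_on_def
proof
  fix p assume p: "p \<in> U"
  with assms(1) obtain a b where "(f has_derivative (\<lambda>h. a * fst h + b * snd h)) (at p)"
    unfolding holo2_on_def by blast
  from Deriv.has_derivative_inverse[OF assms(2)[OF p] this]
  show "\<exists>a b. ((\<lambda>p. inverse (f p)) has_derivative (\<lambda>h. a * fst h + b * snd h)) (at p)"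
    by (intro exI[of _ "- (inverse (f p) * a * inverse (f p))"] exI[of _ "- (inverse (f p) * b * inverse (f p))"])
       (simp add: algebra_simps)
qed

lemma holo2_minus: "holo2_on f U \<Longrightarrow> holo2_on (\<lambda>p. - f p) U"
  using holo2_mult[OF holo2_const[of "-1"]] by fastforce

lemma holo2_diff: "holo2_on f U \<Longrightarrow> holo2_on g U \<Longrightarrow> holo2_on (\<lambda>p. f p - g p) U"
  using holo2_add[OF _ holo2_minus] by fastforce

lemma holo2_divide:
  "holo2_on f U \<Longrightarrow> holo2_on g U \<Longrightarrow> (\<And>p. p \<in> U \<Longrightarrow> g p \<noteq> 0) \<Longrightarrow> holo2_on (\<lambda>p. f p / g p) U"
  unfolding divide_inverse by (intro holo2_mult holo2_inverse) auto

lemma holo2_sum: "(\<And>i. i \<in> I \<Longrightarrow> holo2_on (f i) U) \<Longrightarrow> holo2_on (\<lambda>p. \<Sum>i\<in>I. f i p) U"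
  by (induction I rule: infinite_finite_induct) (auto intro: holo2_const holo2_add)

lemma holo2_prod: "(\<And>i. i \<in> I \<Longrightarrow> holo2_on (f i) U) \<Longrightarrow> holo2_on (\<lambda>p. \<Prod>i\<in>I. f i p) U"
  by (induction I rule: infinite_finite_induct) (auto intro: holo2_const holo2_mult)

lemma holo2_cong:
  assumes "\<And>p. p \<in> V \<Longrightarrow> f p = g p" "open V" "holo2_on f V"
  shows "holo2_on g V"
  unfolding holo2_on_def
proof
  fix p assume p: "p \<in> V"
  then obtain a b where "(f has_derivative (\<lambda>h. a * fst h + b * snd h)) (at p)"
    using assms by (auto simp: holo2_on_def)
  then have "(g has_derivative (\<lambda>h. a * fst h + b * snd h)) (at p)"
    by (rule has_derivative_transform_within_open[of _ _ _ _ V]) (use assms p in auto)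
  then show "\<exists>a b. (g has_derivative (\<lambda>h. a * fst h + b * snd h)) (at p)" by blast
qed

lemma holo2_local:
  assumes "\<And>p. p \<in> U \<Longrightarrow> \<exists>V. p \<in> V \<and> holo2_on f V"
  shows "holo2_on f U"
  using assms unfolding holo2_on_def by blast

lemma holo2_chain:
  assumes U: "open U" and f: "holo2_on f U" and "\<gamma> t \<in> U"
    and "((\<lambda>s. fst (\<gamma> s)) has_field_derivative a) (at t)" "((\<lambda>s. snd (\<gamma> s)) has_field_derivative b) (at t)"
  shows "((\<lambda>s. f (\<gamma> s)) has_field_derivative px f (\<gamma> t) * a + pu f (\<gamma> t) * b) (at t)"
proof -
  have "((\<lambda>s. (fst (\<gamma> s), snd (\<gamma> s))) has_derivative (\<lambda>h. (a * h, b * h))) (at t)"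
    using assms(4,5) by (intro has_derivative_Pair) (auto simp: has_field_derivative_def)
  then have "(\<gamma> has_derivative (\<lambda>h. (a * h, b * h))) (at t)" by simp
  from has_derivative_compose[OF this holo2_has_derivative[OF U f assms(3)]]
  show ?thesis unfolding has_field_derivative_def
    by (rule has_derivative_eq_rhs) (auto simp: algebra_simps)
qed


subsection \<open>Holomorphic second-order differential equations\<close>

text \<open>The equation \<open>u'' = G x u u'\<close> with data \<open>u = b\<close>,
  \<open>u' = c\<close> at \<open>a\<close>, treated as a system for \<open>(u, u')\<close>. The
  last assumption replaces holomorphy in three variables by the one consequence that the Picard
  iteration uses: substituting holomorphic functions into \<open>G\<close> gives a holomorphic
  function.\<close>

locale ode2 =
  fixes G :: "complex \<Rightarrow> complex \<Rightarrow> complex \<Rightarrow> complex" and a b c :: complex and r L M :: real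
  assumes r_pos: "r > 0" and L_nonneg: "L \<ge> 0"
    and bound: "x \<in> ball a r \<Longrightarrow> u \<in> ball b r \<Longrightarrow> v \<in> ball c r \<Longrightarrow> norm (G x u v) \<le> M"
    and lipschitz: "x \<in> ball a r \<Longrightarrow> u \<in> ball b r \<Longrightarrow> v \<in> ball c r \<Longrightarrow> u' \<in> ball b r \<Longrightarrow> v' \<in> ball c r \<Longrightarrow>
          norm (G x u v - G x u' v') \<le> L * (norm (u - u') + norm (v - v'))"
    and holomorphic: "s \<le> r \<Longrightarrow> f holomorphic_on ball a s \<Longrightarrow> g holomorphic_on ball a s \<Longrightarrow>
          f ` ball a s \<subseteq> ball b r \<Longrightarrow> g ` ball a s \<subseteq> ball c r \<Longrightarrow>
          (\<lambda>x. G x (f x) (g x)) holomorphic_on ball a s"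
begin

lemma M_nonneg: "M \<ge> 0"
  using order_trans[OF norm_ge_zero bound[of a b c]] r_pos by simp

text \<open>The third condition makes a Picard step contract by 1/2. The fourth keeps iterates in
  the polydisc, since \<open>u\<close> moves with speed at most \<open>norm c + r\<close> and
  \<open>u'\<close> with speed at most \<open>M\<close>; it is strict so that limits of iterates
  also stay in the open balls.\<close>

definition small :: "real \<Rightarrow> bool" where
  "small s \<longleftrightarrow> 0 < s \<and> s \<le> r \<and> s * (L + 1) \<le> 1 / 2 \<and> s * (M + norm c + r) < r"

definition admissible :: "real \<Rightarrow> (complex \<Rightarrow> complex) \<times> (complex \<Rightarrow> complex) \<Rightarrow> bool" where
  "admissible s w \<longleftrightarrow> fst w holomorphic_on ball a s \<and> snd w holomorphic_on ball a s \<and>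
     fst w ` ball a s \<subseteq> ball b r \<and> snd w ` ball a s \<subseteq> ball c r"

text \<open>One Picard step from \<open>w\<close> to \<open>w'\<close>, stated by derivatives and
  initial values instead of integrals. As a relation it leaves \<open>w'\<close> free outside the
  disc; \<open>picard s w w\<close> says that \<open>w\<close> solves the system.\<close>

definition picard :: "real \<Rightarrow> (complex \<Rightarrow> complex) \<times> (complex \<Rightarrow> complex) \<Rightarrow>
    (complex \<Rightarrow> complex) \<times> (complex \<Rightarrow> complex) \<Rightarrow> bool" where
  "picard s w w' \<longleftrightarrow> fst w' a = b \<and> snd w' a = c \<and>
     (\<forall>x\<in>ball a s. (fst w' has_field_derivative snd w x) (at x) \<and>
        (snd w' has_field_derivative G x (fst w x) (snd w x)) (at x))"

lemma ex_small: "e > 0 \<Longrightarrow> \<exists>s. small s \<and> s \<le> e"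
proof -
  assume e: "e > 0"
  define N where "N = M + norm c + r"
  have N: "N > 0" using r_pos M_nonneg by (simp add: N_def add_nonneg_pos)
  \<comment> \<open>The factor 2 in front of \<open>N\<close> gives \<open>s * N \<le> r / 2\<close>
    and thus the strict inequality in \<open>small\<close>.\<close>
  define s where "s = Min {e, r, 1 / (2 * (L + 1)), r / (2 * N)}"
  have s: "s > 0" "s \<le> e" "s \<le> r" "s \<le> 1 / (2 * (L + 1))" "s \<le> r / (2 * N)"
    using e r_pos L_nonneg N by (auto simp: s_def)
  have "s * (L + 1) \<le> 1 / (2 * (L + 1)) * (L + 1)"
    using L_nonneg s by (intro mult_right_mono) auto
  also have "\<dots> = 1 / 2" using L_nonneg by (simp add: field_simps)
  finally have "s * (L + 1) \<le> 1 / 2" .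
  moreover have "s * N \<le> r / (2 * N) * N"
    using N s by (intro mult_right_mono) auto
  then have "s * N < r" using N r_pos by simp
  ultimately show ?thesis
    using s unfolding small_def N_def by blast
qed

lemma admissibleD:
  assumes "admissible s w" "x \<in> ball a s"
  shows "fst w x \<in> ball b r" "snd w x \<in> ball c r"
  using assms unfolding admissible_def by blast+

lemma primitive_bound:
  assumes "\<And>x. x \<in> ball a s \<Longrightarrow> (F has_field_derivative f x) (at x)"
    and "\<And>x. x \<in> ball a s \<Longrightarrow> norm (f x) \<le> B" and "s > 0" "x \<in> ball a s"
  shows "norm (F x - F a) \<le> s * B"
proof -
  have "norm (F x - F a) \<le> B * norm (x - a)"
    using assms by (intro field_differentiable_bound[of "ball a s" F f])
      (auto intro: has_field_derivative_at_within)
  also have "\<dots> \<le> B * s"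
    using assms(3,4) order_trans[OF norm_ge_zero assms(2)[OF assms(4)]]
    by (intro mult_left_mono) (auto simp: dist_norm norm_minus_commute)
  finally show ?thesis by (simp add: mult.commute)
qed

lemma ex_primitive:
  assumes "f holomorphic_on ball a s"
  shows "\<exists>F. F a = k \<and> (\<forall>x\<in>ball a s. (F has_field_derivative f x) (at x))"
proof -
  obtain F where F: "\<And>x. x \<in> ball a s \<Longrightarrow> (F has_field_derivative f x) (at x within ball a s)"
    using holomorphic_convex_primitive'[OF convex_ball open_ball assms] by blast
  have "((\<lambda>x. F x - F a + k) has_field_derivative f x) (at x)" if "x \<in> ball a s" for x
    using F[OF that] at_within_open[OF that open_ball] by (auto intro!: derivative_eq_intros)
  then show ?thesis by (intro exI[of _ "\<lambda>x. F x - F a + k"]) auto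
qed

lemma picard_bound:
  assumes s: "small s" and w: "admissible s w" and p: "picard s w w'" and x: "x \<in> ball a s"
  shows "norm (fst w' x - b) \<le> s * (M + norm c + r)" "norm (snd w' x - c) \<le> s * (M + norm c + r)"
proof -
  have 1: "s > 0" "s \<le> r" using s by (auto simp: small_def)
  have "norm (fst w' x - fst w' a) \<le> s * (M + norm c + r)"
  proof (rule primitive_bound[OF _ _ \<open>s > 0\<close> x])
    show "(fst w' has_field_derivative snd w z) (at z)" if "z \<in> ball a s" for z
      using p that by (auto simp: picard_def)
    show "norm (snd w z) \<le> M + norm c + r" if "z \<in> ball a s" for z
    proof -
      have "snd w z \<in> ball c r" using admissibleD[OF w that] by simp
      then have "norm (snd w z - c) < r" by (simp add: dist_norm norm_minus_commute)
      moreover have "norm (snd w z) \<le> norm (snd w z - c) + norm c"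
        by (metis diff_add_cancel norm_triangle_ineq)
      ultimately show ?thesis using M_nonneg by linarith
    qed
  qed
  then show "norm (fst w' x - b) \<le> s * (M + norm c + r)" using p by (simp add: picard_def)
  have "norm (snd w' x - snd w' a) \<le> s * M"
  proof (rule primitive_bound[OF _ _ \<open>s > 0\<close> x])
    show "(snd w' has_field_derivative G z (fst w z) (snd w z)) (at z)" if "z \<in> ball a s" for z
      using p that by (auto simp: picard_def)
    show "norm (G z (fst w z) (snd w z)) \<le> M" if "z \<in> ball a s" for z
      using that \<open>s \<le> r\<close> by (intro bound admissibleD[OF w]) auto
  qed
  also have "\<dots> \<le> s * (M + norm c + r)" using 1 r_pos by (intro mult_left_mono) auto
  finally show "norm (snd w' x - c) \<le> s * (M + norm c + r)" using p by (simp add: picard_def)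
qed

lemma picard_admissible:
  assumes s: "small s" and w: "admissible s w" and p: "picard s w w'"
  shows "admissible s w'"
proof -
  have "norm (fst w' x - b) < r \<and> norm (snd w' x - c) < r" if "x \<in> ball a s" for x
    using picard_bound[OF s w p that] s by (auto simp: small_def)
  moreover have "fst w' holomorphic_on ball a s" "snd w' holomorphic_on ball a s"
    using p unfolding picard_def holomorphic_on_open[OF open_ball] by blast+
  ultimately show ?thesis by (auto simp: admissible_def dist_norm norm_minus_commute)
qed

lemma ex_picard:
  assumes s: "small s" and w: "admissible s w"
  shows "\<exists>w'. picard s w w'"
proof -
  have "(\<lambda>x. G x (fst w x) (snd w x)) holomorphic_on ball a s"
    using s w by (intro holomorphic) (auto simp: small_def admissible_def)
  from ex_primitive[OF this, of c]
  obtain H where "H a = c" "\<forall>x\<in>ball a s. (H has_field_derivative G x (fst w x) (snd w x)) (at x)" by blast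
  moreover have "snd w holomorphic_on ball a s" using w by (simp add: admissible_def)
  from ex_primitive[OF this, of b]
  obtain F where "F a = b" "\<forall>x\<in>ball a s. (F has_field_derivative snd w x) (at x)" by blast
  ultimately show ?thesis by (intro exI[of _ "(F, H)"]) (auto simp: picard_def)
qed

text \<open>In the sum of the two norms, the primitive of the difference of the slopes contributes
  \<open>s * K\<close>, the primitive of the difference of the values of \<open>G\<close>
  contributes \<open>s * (L * K)\<close>, and \<open>s * (L + 1)\<close> is at most 1/2.\<close>

lemma picard_contraction:
  assumes s: "small s" and w: "admissible s w1" "admissible s w2" and p: "picard s w1 w1'" "picard s w2 w2'"
    and K: "\<And>x. x \<in> ball a s \<Longrightarrow> norm (fst w1 x - fst w2 x) + norm (snd w1 x - snd w2 x) \<le> K"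
    and x: "x \<in> ball a s"
  shows "norm (fst w1' x - fst w2' x) + norm (snd w1' x - snd w2' x) \<le> K / 2"
proof -
  have 1: "s > 0" "s \<le> r" using s by (auto simp: small_def)
  have K0: "K \<ge> 0" using K[OF x] norm_ge_zero by (smt (verit))
  have "norm ((fst w1' x - fst w2' x) - (fst w1' a - fst w2' a)) \<le> s * K"
  proof (rule primitive_bound[OF _ _ \<open>s > 0\<close> x, where f = "\<lambda>x. snd w1 x - snd w2 x"])
    show "((\<lambda>x. fst w1' x - fst w2' x) has_field_derivative snd w1 z - snd w2 z) (at z)"
      if "z \<in> ball a s" for z
      using p that by (intro derivative_intros) (auto simp: picard_def)
    show "norm (snd w1 z - snd w2 z) \<le> K" if "z \<in> ball a s" for z
      using K[OF that] norm_ge_zero[of "fst w1 z - fst w2 z"] by linarith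
  qed
  moreover have "norm ((snd w1' x - snd w2' x) - (snd w1' a - snd w2' a)) \<le> s * (L * K)"
  proof (rule primitive_bound[OF _ _ \<open>s > 0\<close> x,
         where f = "\<lambda>x. G x (fst w1 x) (snd w1 x) - G x (fst w2 x) (snd w2 x)"])
    show "((\<lambda>x. snd w1' x - snd w2' x) has_field_derivative
        G z (fst w1 z) (snd w1 z) - G z (fst w2 z) (snd w2 z)) (at z)" if "z \<in> ball a s" for z
      using p that by (intro derivative_intros) (auto simp: picard_def)
    show "norm (G z (fst w1 z) (snd w1 z) - G z (fst w2 z) (snd w2 z)) \<le> L * K" if z: "z \<in> ball a s" for z
    proof -
      have "norm (G z (fst w1 z) (snd w1 z) - G z (fst w2 z) (snd w2 z))
          \<le> L * (norm (fst w1 z - fst w2 z) + norm (snd w1 z - snd w2 z))"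
        using z \<open>s \<le> r\<close> by (intro lipschitz admissibleD[OF w(1)] admissibleD[OF w(2)]) auto
      also have "\<dots> \<le> L * K" using K[OF z] L_nonneg by (intro mult_left_mono)
      finally show ?thesis .
    qed
  qed
  ultimately have "norm (fst w1' x - fst w2' x) + norm (snd w1' x - snd w2' x) \<le> s * K + s * (L * K)"
    using p by (simp add: picard_def)
  also have "\<dots> = s * (L + 1) * K" by (simp add: algebra_simps)
  also have "\<dots> \<le> 1 / 2 * K" using s K0 by (intro mult_right_mono) (auto simp: small_def)
  finally show ?thesis by simp
qed

text \<open>Crude starting distance for the iteration: one diameter \<open>2 * r\<close> for each of
  the two components.\<close>

lemma admissible_diff:
  assumes "admissible s w1" "admissible s w2" "x \<in> ball a s"
  shows "norm (fst w1 x - fst w2 x) + norm (snd w1 x - snd w2 x) \<le> 4 * r"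
proof -
  have "fst w1 x \<in> ball b r" "fst w2 x \<in> ball b r" "snd w1 x \<in> ball c r" "snd w2 x \<in> ball c r"
    using assms by (auto dest: admissibleD simp del: mem_ball)
  then have "dist (fst w1 x) (fst w2 x) \<le> 2 * r" "dist (snd w1 x) (snd w2 x) \<le> 2 * r"
    using dist_triangle2[of "fst w1 x" "fst w2 x" b] dist_triangle2[of "snd w1 x" "snd w2 x" c]
    by (auto simp: dist_commute)
  then show ?thesis by (simp add: dist_norm)
qed

text \<open>Fixed points are their own images, so the contraction may be applied to the two of them
  \<open>n\<close> times, for every \<open>n\<close>.\<close>

lemma picard_unique:
  assumes s: "small s" and w: "admissible s w1" "admissible s w2" and p: "picard s w1 w1" "picard s w2 w2"
    and x: "x \<in> ball a s"
  shows "fst w1 x = fst w2 x"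
proof -
  have *: "\<forall>x\<in>ball a s. norm (fst w1 x - fst w2 x) + norm (snd w1 x - snd w2 x) \<le> 4 * r * (1 / 2) ^ n" for n
  proof (induction n)
    case 0
    then show ?case using admissible_diff[OF w] by auto
  next
    case (Suc n)
    then show ?case using picard_contraction[OF s w p, of "4 * r * (1 / 2) ^ n"] by fastforce
  qed
  have "(\<lambda>n. 4 * r * (1 / 2) ^ n) \<longlonglongrightarrow> 4 * r * 0"
    by (intro tendsto_mult_left LIMSEQ_realpow_zero) auto
  then have "norm (fst w1 x - fst w2 x) + norm (snd w1 x - snd w2 x) \<le> 4 * r * 0"
    using * x by (intro LIMSEQ_le_const) auto
  then have "norm (fst w1 x - fst w2 x) \<le> 0"
    using norm_ge_zero[of "snd w1 x - snd w2 x"] by linarith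
  then show ?thesis by simp
qed

text \<open>The increments are dominated by a geometric series, so the Weierstrass test applies to
  the telescoping sum.\<close>

lemma telescope_uniform_limit:
  fixes f :: "nat \<Rightarrow> complex \<Rightarrow> complex"
  assumes "\<And>n x. x \<in> S \<Longrightarrow> norm (f (Suc n) x - f n x) \<le> K * (1 / 2) ^ n"
  shows "\<exists>g. uniform_limit S f g sequentially"
proof -
  have "summable (\<lambda>n. K * (1 / 2) ^ n)"
    by (intro summable_mult summable_geometric) auto
  then have "uniform_limit S (\<lambda>n x. \<Sum>i<n. f (Suc i) x - f i x) (\<lambda>x. \<Sum>i. f (Suc i) x - f i x) sequentially"
    using assms by (intro Weierstrass_m_test) auto
  then have "uniform_limit S (\<lambda>n x. f 0 x + (\<Sum>i<n. f (Suc i) x - f i x))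
      (\<lambda>x. f 0 x + (\<Sum>i. f (Suc i) x - f i x)) sequentially"
    by (intro uniform_limit_add uniform_limit_const)
  moreover have "(\<lambda>n x. f 0 x + (\<Sum>i<n. f (Suc i) x - f i x)) = f"
    using sum_lessThan_telescope[of "\<lambda>i. f i x" for x] by (auto simp: fun_eq_iff)
  ultimately show ?thesis by auto
qed

text \<open>Limit of successive approximations. Uniform convergence allows termwise differentiation,
  so the relation between consecutive iterates becomes the fixed point relation of the
  limit.\<close>

lemma picard_fixpoint:
  assumes s: "small s"
  shows "\<exists>w. admissible s w \<and> picard s w w"
proof -
  have "\<exists>W. \<forall>n. admissible s (W n) \<and> picard s (W n) (W (Suc n))"
  proof (rule dependent_nat_choice)
    show "\<exists>w. admissible s w"
      using r_pos by (intro exI[of _ "(\<lambda>_. b, \<lambda>_. c)"]) (auto simp: admissible_def)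
    show "\<exists>w'. admissible s w' \<and> picard s w w'" if "admissible s w" for w n
      using ex_picard[OF s that] picard_admissible[OF s that] by blast
  qed
  then obtain W where adm: "\<And>n. admissible s (W n)" and pic: "\<And>n. picard s (W n) (W (Suc n))" by blast
  have *: "\<forall>x\<in>ball a s. norm (fst (W (Suc n)) x - fst (W n) x) + norm (snd (W (Suc n)) x - snd (W n) x)
      \<le> 4 * r * (1 / 2) ^ n" for n
  proof (induction n)
    case 0
    then show ?case using admissible_diff[OF adm adm] by auto
  next
    case (Suc n)
    then show ?case
      using picard_contraction[OF s adm adm pic pic, of "Suc n" n "4 * r * (1 / 2) ^ n"] by fastforce
  qed
  have "norm (fst (W (Suc n)) x - fst (W n) x) \<le> 4 * r * (1 / 2) ^ n"
    and "norm (snd (W (Suc n)) x - snd (W n) x) \<le> 4 * r * (1 / 2) ^ n" if "x \<in> ball a s" for n x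
    using *[of n] that norm_ge_zero[of "fst (W (Suc n)) x - fst (W n) x"]
      norm_ge_zero[of "snd (W (Suc n)) x - snd (W n) x"] by (smt (verit))+
  then obtain f g where fg: "uniform_limit (ball a s) (\<lambda>n. fst (W n)) f sequentially"
      "uniform_limit (ball a s) (\<lambda>n. snd (W n)) g sequentially"
    using telescope_uniform_limit[of "ball a s" "\<lambda>n. fst (W n)" "4 * r"]
      telescope_uniform_limit[of "ball a s" "\<lambda>n. snd (W n)" "4 * r"] by blast
  have ful: "uniform_limit (ball a s) (\<lambda>n. fst (W (Suc n))) f sequentially"
    and gul: "uniform_limit (ball a s) (\<lambda>n. snd (W (Suc n))) g sequentially"
    using filterlim_compose[OF fg(1) filterlim_Suc] filterlim_compose[OF fg(2) filterlim_Suc] .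
  have flim: "(\<lambda>n. fst (W n) x) \<longlonglongrightarrow> f x" and glim: "(\<lambda>n. snd (W n) x) \<longlonglongrightarrow> g x"
    if "x \<in> ball a s" for x
    using fg that by (auto intro: tendsto_uniform_limitI)
  have s': "s > 0" "s \<le> r" using s by (auto simp: small_def)
  \<comment> \<open>Weak bounds survive the limit; the strict inequality in \<open>small\<close>
    then puts the limit into the open balls.\<close>
  have fr: "norm (f x - b) \<le> s * (M + norm c + r)" and gr: "norm (g x - c) \<le> s * (M + norm c + r)"
    if x: "x \<in> ball a s" for x
  proof -
    have "(\<lambda>n. norm (fst (W (Suc n)) x - b)) \<longlonglongrightarrow> norm (f x - b)"
      by (intro tendsto_intros LIMSEQ_Suc[OF flim] x)
    then show "norm (f x - b) \<le> s * (M + norm c + r)"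
      by (rule LIMSEQ_le_const2) (use picard_bound(1)[OF s adm pic x] in blast)
    have "(\<lambda>n. norm (snd (W (Suc n)) x - c)) \<longlonglongrightarrow> norm (g x - c)"
      by (intro tendsto_intros LIMSEQ_Suc[OF glim] x)
    then show "norm (g x - c) \<le> s * (M + norm c + r)"
      by (rule LIMSEQ_le_const2) (use picard_bound(2)[OF s adm pic x] in blast)
  qed
  have fb: "f x \<in> ball b r" and gb: "g x \<in> ball c r" if "x \<in> ball a s" for x
    using fr[OF that] gr[OF that] s by (auto simp: small_def dist_norm norm_minus_commute)
  have loc: "\<exists>d>0. cball x d \<subseteq> ball a s \<and> uniform_limit (cball x d) k l sequentially"
    if "uniform_limit (ball a s) k l sequentially" "x \<in> ball a s" for k l and x :: complex
    using that by (meson open_ball open_contains_cball uniform_limit_on_subset)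
  have "\<exists>f'. \<forall>x\<in>ball a s. (f has_field_derivative f' x) (at x) \<and> (\<lambda>n. snd (W n) x) \<longlonglongrightarrow> f' x"
    using pic by (intro has_complex_derivative_uniform_sequence[OF open_ball _ loc[OF ful]])
      (auto simp: picard_def)
  then have df: "(f has_field_derivative g x) (at x)" if "x \<in> ball a s" for x
    using glim[OF that] that LIMSEQ_unique by metis
  \<comment> \<open>Convergence of the right-hand sides comes from the Lipschitz condition in the
    last two arguments.\<close>
  have Glim: "(\<lambda>n. G x (fst (W n) x) (snd (W n) x)) \<longlonglongrightarrow> G x (f x) (g x)" if x: "x \<in> ball a s" for x
  proof (rule LIM_zero_cancel, rule Lim_null_comparison)
    have "(\<lambda>n. L * (norm (fst (W n) x - f x) + norm (snd (W n) x - g x)))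
        \<longlonglongrightarrow> L * (norm (f x - f x) + norm (g x - g x))"
      by (intro tendsto_intros flim glim x)
    then show "(\<lambda>n. L * (norm (fst (W n) x - f x) + norm (snd (W n) x - g x))) \<longlonglongrightarrow> 0" by simp
    have "norm (G x (fst (W n) x) (snd (W n) x) - G x (f x) (g x))
      \<le> L * (norm (fst (W n) x - f x) + norm (snd (W n) x - g x))" for n
      using x fb[OF x] gb[OF x] s' by (intro lipschitz admissibleD[OF adm]) auto
    then show "\<forall>\<^sub>F n in sequentially. norm (G x (fst (W n) x) (snd (W n) x) - G x (f x) (g x))
      \<le> L * (norm (fst (W n) x - f x) + norm (snd (W n) x - g x))" by simp
  qed
  have "\<exists>g'. \<forall>x\<in>ball a s. (g has_field_derivative g' x) (at x) \<and>
      (\<lambda>n. G x (fst (W n) x) (snd (W n) x)) \<longlonglongrightarrow> g' x"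
    using pic by (intro has_complex_derivative_uniform_sequence[OF open_ball _ loc[OF gul]])
      (auto simp: picard_def)
  then have dg: "(g has_field_derivative G x (f x) (g x)) (at x)" if "x \<in> ball a s" for x
    using Glim[OF that] that LIMSEQ_unique by metis
  have a: "a \<in> ball a s" using s' by simp
  have "(\<lambda>n. fst (W (Suc n)) a) \<longlonglongrightarrow> f a" "(\<lambda>n. snd (W (Suc n)) a) \<longlonglongrightarrow> g a"
    using LIMSEQ_Suc[OF flim[OF a]] LIMSEQ_Suc[OF glim[OF a]] .
  then have "f a = b" "g a = c"
    using pic by (auto simp: picard_def LIMSEQ_const_iff)
  then have pw: "picard s (f, g) (f, g)"
    using df dg by (auto simp: picard_def)
  moreover have "f holomorphic_on ball a s" "g holomorphic_on ball a s"
    using df dg unfolding holomorphic_on_open[OF open_ball] by blast+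
  then have "admissible s (f, g)" using fb gb by (auto simp: admissible_def)
  ultimately show ?thesis by blast
qed

lemma solution_exists:
  obtains s f where "s > 0" "s \<le> r" "f holomorphic_on ball a s" "f ` ball a s \<subseteq> ball b r"
    "f a = b" "deriv f a = c" "\<And>x. x \<in> ball a s \<Longrightarrow> deriv (deriv f) x = G x (f x) (deriv f x)"
proof -
  obtain s where s: "small s" using ex_small[OF zero_less_one] by blast
  obtain w where w: "admissible s w" "picard s w w" using picard_fixpoint[OF s] by blast
  have s': "s > 0" "s \<le> r" using s by (auto simp: small_def)
  have d: "deriv (fst w) x = snd w x" if "x \<in> ball a s" for x
    using w(2) that by (auto simp: picard_def DERIV_imp_deriv)
  show thesis
  proof (rule that[OF s'])
    show "fst w holomorphic_on ball a s" "fst w ` ball a s \<subseteq> ball b r" "fst w a = b"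
      using w by (auto simp: admissible_def picard_def)
    show "deriv (fst w) a = c" using d[of a] s' w(2) by (simp add: picard_def)
    show "deriv (deriv (fst w)) x = G x (fst w x) (deriv (fst w) x)" if x: "x \<in> ball a s" for x
    proof -
      have "(snd w has_field_derivative G x (fst w x) (snd w x)) (at x)"
        using w(2) x by (auto simp: picard_def)
      then have "(deriv (fst w) has_field_derivative G x (fst w x) (snd w x)) (at x)"
        by (rule has_field_derivative_transform_within_open[OF _ open_ball x]) (simp add: d)
      then show ?thesis by (simp add: DERIV_imp_deriv d[OF x])
    qed
  qed
qed

text \<open>On a disc so small that, by continuity, a solution and its derivative stay in the balls
  of the locale, the solution is a fixed point of the Picard step, and \<open>picard_unique\<close>
  applies.\<close>

lemma solution_unique:
  assumes "e > 0" and f: "f holomorphic_on ball a e" "f a = b" "deriv f a = c"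
      "\<And>x. x \<in> ball a e \<Longrightarrow> deriv (deriv f) x = G x (f x) (deriv f x)"
    and g: "g holomorphic_on ball a e" "g a = b" "deriv g a = c"
      "\<And>x. x \<in> ball a e \<Longrightarrow> deriv (deriv g) x = G x (g x) (deriv g x)"
  obtains s where "s > 0" "\<And>x. x \<in> ball a s \<Longrightarrow> f x = g x"
proof -
  have near: "\<exists>d>0. h ` ball a d \<subseteq> ball (h a) r" if "h holomorphic_on ball a e" for h
  proof -
    have "isCont h a"
      using that \<open>e > 0\<close> holomorphic_on_imp_continuous_on continuous_on_eq_continuous_at
      by (metis centre_in_ball open_ball)
    then show ?thesis using r_pos unfolding continuous_at_ball by blast
  qed
  have hd: "deriv f holomorphic_on ball a e" "deriv g holomorphic_on ball a e"
    using f(1) g(1) by (auto intro: holomorphic_deriv)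
  obtain d1 d2 d3 d4 where d: "d1 > 0" "d2 > 0" "d3 > 0" "d4 > 0"
     "f ` ball a d1 \<subseteq> ball b r" "deriv f ` ball a d2 \<subseteq> ball c r"
     "g ` ball a d3 \<subseteq> ball b r" "deriv g ` ball a d4 \<subseteq> ball c r"
    using near[OF f(1)] near[OF g(1)] near[OF hd(1)] near[OF hd(2)] unfolding f(2,3) g(2,3) by metis
  then obtain s where s: "small s" "s \<le> min e (min (min d1 d2) (min d3 d4))"
    using ex_small[of "min e (min (min d1 d2) (min d3 d4))"] \<open>e > 0\<close> by auto
  have sub: "ball a s \<subseteq> ball a e" "ball a s \<subseteq> ball a d1" "ball a s \<subseteq> ball a d2"
     "ball a s \<subseteq> ball a d3" "ball a s \<subseteq> ball a d4" using s(2) by auto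
  have der: "(h has_field_derivative deriv h x) (at x)" if "h holomorphic_on ball a e" "x \<in> ball a s" for h x
    using that sub(1) by (auto intro!: holomorphic_derivI[of _ "ball a e"])
  have "admissible s (f, deriv f)" "admissible s (g, deriv g)"
    unfolding admissible_def fst_conv snd_conv
    using d(5-8) sub f(1) g(1) hd by (meson holomorphic_on_subset image_mono order_trans)+
  moreover have "picard s (f, deriv f) (f, deriv f)"
    unfolding picard_def fst_conv snd_conv
    using der[OF f(1)] der[OF hd(1)] f(2,3) f(4)[OF subsetD[OF sub(1)]] by simp
  moreover have "picard s (g, deriv g) (g, deriv g)"
    unfolding picard_def fst_conv snd_conv
    using der[OF g(1)] der[OF hd(2)] g(2,3) g(4)[OF subsetD[OF sub(1)]] by simp
  ultimately have "f x = g x" if "x \<in> ball a s" for x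
    using picard_unique[OF s(1) _ _ _ _ that] by fastforce
  then show thesis using that s(1) by (auto simp: small_def)
qed

end

section \<open>The cubic right-hand side as an instance of the general theory\<close>

definition cubic_rhs where
  "cubic_rhs A B C D x u v = A (x, u) + B (x, u) * v + C (x, u) * v ^ 2 + D (x, u) * (v::complex) ^ 3"
  for A B C D :: "complex \<times> complex \<Rightarrow> complex"

text \<open>Compactness of a closed polydisc bounds the right-hand side and its partial derivatives
  \<open>Gu\<close>, \<open>Gv\<close> in \<open>u\<close> and \<open>v\<close>; the mean value
  inequality turns the latter into a Lipschitz constant. The right-hand side is polynomial in
  \<open>v\<close>, so only \<open>(x, u)\<close> has to stay in \<open>U\<close> and the ball about
  the slope \<open>c\<close> can have the same radius.\<close>

lemma cubic_rhs_ode2: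
  assumes U: "open U" and h: "holo2_on A U" "holo2_on B U" "holo2_on C U" "holo2_on D U"
    and p: "(a, b) \<in> U"
  obtains r L M where "ode2 (cubic_rhs A B C D) a b c r L M" "cball a r \<times> cball b r \<subseteq> U"
proof -
  obtain r where r: "r > 0" "cball a r \<times> cball b r \<subseteq> U"
    using open_contains_bidisc[OF U p] by auto
  let ?K = "(cball a r \<times> cball b r) \<times> cball c r"
  have comp: "compact ?K" by (intro compact_Times compact_cball)
  have co: "continuous_on ?K (\<lambda>z. F (fst z))" if "holo2_on F U" for F
    by (rule continuous_on_compose2[OF holo2_continuous[OF that]])
       (use r(2) in \<open>auto intro!: continuous_intros\<close>)
  define Gu where "Gu z = pu A (fst z) + pu B (fst z) * snd z + pu C (fst z) * snd z ^ 2 + pu D (fst z) * snd z ^ 3"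
    for z :: "(complex \<times> complex) \<times> complex"
  define Gv where "Gv z = B (fst z) + C (fst z) * (2 * snd z) + D (fst z) * (3 * snd z ^ 2)"
    for z :: "(complex \<times> complex) \<times> complex"
  define Gz where "Gz z = cubic_rhs A B C D (fst (fst z)) (snd (fst z)) (snd z)"
    for z :: "(complex \<times> complex) \<times> complex"
  have "continuous_on ?K Gu" "continuous_on ?K Gv" "continuous_on ?K Gz"
    unfolding Gu_def Gv_def Gz_def cubic_rhs_def prod.collapse
    by (intro continuous_intros co h holo2_pu U)+
  then have "bounded (Gu ` ?K)" "bounded (Gv ` ?K)" "bounded (Gz ` ?K)"
    by (auto intro!: compact_imp_bounded compact_continuous_image comp)
  then obtain L1 L2 M where L1: "\<And>z. z \<in> ?K \<Longrightarrow> norm (Gu z) \<le> L1"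
    and L2: "\<And>z. z \<in> ?K \<Longrightarrow> norm (Gv z) \<le> L2" and M: "\<And>z. z \<in> ?K \<Longrightarrow> norm (Gz z) \<le> M"
    unfolding bounded_iff by (metis imageI)
  have mid: "((a, b), c) \<in> ?K" using r by auto
  have L0: "L1 \<ge> 0" "L2 \<ge> 0"
    using L1[OF mid] L2[OF mid] norm_ge_zero order_trans by blast+
  have "ode2 (cubic_rhs A B C D) a b c r (L1 + L2) M"
  proof
    show "r > 0" "L1 + L2 \<ge> 0" using r L0 by auto
    show "norm (cubic_rhs A B C D x u v) \<le> M" if "x \<in> ball a r" "u \<in> ball b r" "v \<in> ball c r" for x u v
      using M[of "((x, u), v)"] that by (auto simp: Gz_def)
    show "norm (cubic_rhs A B C D x u v - cubic_rhs A B C D x u' v')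
        \<le> (L1 + L2) * (norm (u - u') + norm (v - v'))"
      if "x \<in> ball a r" "u \<in> ball b r" "v \<in> ball c r" "u' \<in> ball b r" "v' \<in> ball c r" for x u v u' v'
    proof -
      have du: "((\<lambda>w. F (x, w)) has_field_derivative pu F (x, w)) (at w)"
        if "holo2_on F U" "w \<in> ball b r" for F w
        using that \<open>x \<in> ball a r\<close> r(2) by (intro sep_holo_onD(2)[OF holo2_imp_sep]) auto
      \<comment> \<open>\<open>u\<close> is changed first and \<open>v\<close> afterwards, with one
        mean value estimate for each.\<close>
      have "norm (cubic_rhs A B C D x u v - cubic_rhs A B C D x u' v) \<le> L1 * norm (u - u')"
      proof (rule field_differentiable_bound[of "ball b r" _ "\<lambda>w. Gu ((x, w), v)"])
        show "((\<lambda>w. cubic_rhs A B C D x w v) has_field_derivative Gu ((x, w), v)) (at w within ball b r)"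
          if "w \<in> ball b r" for w
          unfolding cubic_rhs_def Gu_def fst_conv snd_conv
          by (intro DERIV_add DERIV_cmult_right has_field_derivative_at_within[OF du] h that)
        show "norm (Gu ((x, w), v)) \<le> L1" if "w \<in> ball b r" for w
          using that \<open>x \<in> ball a r\<close> \<open>v \<in> ball c r\<close> by (intro L1) auto
      qed (use that in auto)
      moreover have "norm (cubic_rhs A B C D x u' v - cubic_rhs A B C D x u' v') \<le> L2 * norm (v - v')"
      proof (rule field_differentiable_bound[of "ball c r" _ "\<lambda>w. Gv ((x, u'), w)"])
        show "(cubic_rhs A B C D x u' has_field_derivative Gv ((x, u'), w)) (at w within ball c r)"
          if "w \<in> ball c r" for w
          unfolding cubic_rhs_def[abs_def] Gv_def fst_conv snd_conv
          by (auto intro!: derivative_eq_intros)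
        show "norm (Gv ((x, u'), w)) \<le> L2" if "w \<in> ball c r" for w
          using that \<open>x \<in> ball a r\<close> \<open>u' \<in> ball b r\<close> by (intro L2) auto
      qed (use that in auto)
      moreover have "norm (cubic_rhs A B C D x u v - cubic_rhs A B C D x u' v') \<le>
        norm (cubic_rhs A B C D x u v - cubic_rhs A B C D x u' v) +
        norm (cubic_rhs A B C D x u' v - cubic_rhs A B C D x u' v')"
        by (metis diff_add_cancel add_diff_eq norm_triangle_ineq)
      moreover have "0 \<le> L2 * norm (u - u')" "0 \<le> L1 * norm (v - v')" using L0 by auto
      ultimately show ?thesis unfolding distrib_left distrib_right by linarith
    qed
    show "(\<lambda>x. cubic_rhs A B C D x (f x) (g x)) holomorphic_on ball a s"
      if "s \<le> r" "f holomorphic_on ball a s" "g holomorphic_on ball a s" "f ` ball a s \<subseteq> ball b r" for s f g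
    proof -
      have "(\<lambda>x. F (x, f x)) holomorphic_on ball a s" if F: "holo2_on F U" for F
        unfolding holomorphic_on_open[OF open_ball]
      proof
        fix x assume x: "x \<in> ball a s"
        have "(f has_field_derivative deriv f x) (at x)"
          using \<open>f holomorphic_on _\<close> x by (auto intro: holomorphic_derivI)
        moreover have "(x, f x) \<in> U" using x \<open>s \<le> r\<close> \<open>f ` _ \<subseteq> _\<close> r(2) by fastforce
        ultimately show "\<exists>d. ((\<lambda>x. F (x, f x)) has_field_derivative d) (at x)"
          using holo2_chain[OF U F, of "\<lambda>x. (x, f x)" x 1 "deriv f x"] by auto
      qed
      then show ?thesis unfolding cubic_rhs_def using h \<open>g holomorphic_on _\<close> by (intro holomorphic_intros) auto
    qed
  qed
  then show thesis using that r(2) by blast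
qed


subsection \<open>Integral curves and their germs\<close>

text \<open>Pointwise version of \<open>integral_curve\<close>, since germs and changes of parameter
  concern one parameter value at a time.\<close>

definition ode_at where
  "ode_at A B C D \<gamma> t \<longleftrightarrow>
     (let dx = deriv (\<lambda>s. fst (\<gamma> s)) t; du = deriv (\<lambda>s. snd (\<gamma> s)) t;
          ddx = deriv (deriv (\<lambda>s. fst (\<gamma> s))) t; ddu = deriv (deriv (\<lambda>s. snd (\<gamma> s))) t
      in dx * ddu - du * ddx =
           A (\<gamma> t) * dx ^ 3 + B (\<gamma> t) * dx ^ 2 * du + C (\<gamma> t) * dx * du ^ 2 + D (\<gamma> t) * du ^ 3)"
  for A B C D :: "complex \<times> complex \<Rightarrow> complex" and \<gamma> :: "complex \<Rightarrow> complex \<times> complex"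

lemma integral_curve_iff: "integral_curve A B C D T \<gamma> \<longleftrightarrow> (\<forall>t\<in>T. ode_at A B C D \<gamma> t)"
  unfolding integral_curve_def ode_at_def velocity_def fst_conv snd_conv by simp

section \<open>Exchange of the coordinates in the equation\<close>

definition neg_swap :: "(complex \<times> complex \<Rightarrow> complex) \<Rightarrow> complex \<times> complex \<Rightarrow> complex" where
  "neg_swap A p = - A (prod.swap p)"

text \<open>Exchanging \<open>x\<close> and \<open>u\<close> changes the sign of
  \<open>dx * ddu - du * ddx\<close> and reverses the order of the four cubic monomials.\<close>

lemma ode_at_swap:
  "ode_at (neg_swap D) (neg_swap C) (neg_swap B) (neg_swap A) (\<lambda>t. prod.swap (\<gamma> t)) t \<longleftrightarrow> ode_at A B C D \<gamma> t"
  unfolding ode_at_def neg_swap_def Let_def swap_swap fst_swap snd_swap by algebra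

lemma holo2_neg_swap: "open U \<Longrightarrow> holo2_on A U \<Longrightarrow> holo2_on (neg_swap A) (prod.swap ` U)"
  using holo2_minus[OF holo2_swap] by (fastforce simp: neg_swap_def[abs_def])

lemma curve_on_swap: "curve_on U T \<gamma> \<Longrightarrow> curve_on (prod.swap ` U) T (\<lambda>t. prod.swap (\<gamma> t))"
  by (auto simp: curve_on_def velocity_def)

lemma integral_curve_swap:
  "integral_curve (neg_swap D) (neg_swap C) (neg_swap B) (neg_swap A) T (\<lambda>t. prod.swap (\<gamma> t))
     \<longleftrightarrow> integral_curve A B C D T \<gamma>"
  by (simp add: integral_curve_iff ode_at_swap)

lemma same_direction_swap:
  "same_direction (velocity (\<lambda>t. prod.swap (\<gamma>1 t)) t1) (velocity (\<lambda>t. prod.swap (\<gamma>2 t)) t2)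
     \<longleftrightarrow> same_direction (velocity \<gamma>1 t1) (velocity \<gamma>2 t2)"
  by (auto simp: same_direction_def velocity_def)

lemma same_germ_swap:
  "same_germ (\<lambda>t. prod.swap (\<gamma>1 t)) t1 (\<lambda>t. prod.swap (\<gamma>2 t)) t2 \<longleftrightarrow> same_germ \<gamma>1 t1 \<gamma>2 t2"
proof -
  have inj: "prod.swap p = prod.swap q \<longleftrightarrow> p = q" for p q :: "complex \<times> complex"
    by (metis swap_swap)
  show ?thesis unfolding same_germ_def inj ..
qed

section \<open>Change of parameter\<close>

definition regular_at :: "(complex \<Rightarrow> complex \<times> complex) \<Rightarrow> complex \<Rightarrow> bool" where
  "regular_at \<gamma> t \<longleftrightarrow> (\<lambda>s. fst (\<gamma> s)) analytic_on {t} \<and> (\<lambda>s. snd (\<gamma> s)) analytic_on {t}"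

lemma curve_on_regular: "curve_on U T \<gamma> \<Longrightarrow> t \<in> T \<Longrightarrow> regular_at \<gamma> t"
  unfolding regular_at_def curve_on_def analytic_at by blast

text \<open>The chain rule twice. As \<open>g\<close> agrees with the composition only near
  \<open>t\<close>, the first derivative is computed on a whole neighbourhood \<open>V\<close>
  before it is differentiated again.\<close>

lemma deriv_reparam:
  fixes f :: "complex \<Rightarrow> complex"
  assumes f: "f analytic_on {\<phi> t}" and \<phi>: "\<phi> analytic_on {t}" and eq: "\<forall>\<^sub>F s in nhds t. g s = f (\<phi> s)"
  shows "deriv g t = deriv f (\<phi> t) * deriv \<phi> t"
    and "deriv (deriv g) t = deriv (deriv f) (\<phi> t) * deriv \<phi> t ^ 2 + deriv f (\<phi> t) * deriv (deriv \<phi>) t"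
proof -
  obtain S where S: "open S" "\<phi> t \<in> S" "f holomorphic_on S" using f unfolding analytic_at by blast
  obtain R where R: "open R" "t \<in> R" "\<phi> holomorphic_on R" using \<phi> unfolding analytic_at by blast
  have "open (R \<inter> \<phi> -` S)"
    by (intro continuous_open_preimage holomorphic_on_imp_continuous_on R S)
  moreover obtain Q where Q: "open Q" "t \<in> Q" "\<And>s. s \<in> Q \<Longrightarrow> g s = f (\<phi> s)"
    using eq unfolding eventually_nhds by blast
  ultimately obtain V where V: "open V" "t \<in> V" "V \<subseteq> Q" "V \<subseteq> R" "\<phi> ` V \<subseteq> S"
    using that[of "R \<inter> \<phi> -` S \<inter> Q"] S R by auto
  have d\<phi>: "(\<phi> has_field_derivative deriv \<phi> s) (at s)" if "s \<in> V" for s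
    using that V R by (intro holomorphic_derivI[of _ R]) auto
  have dg: "(g has_field_derivative deriv f (\<phi> s) * deriv \<phi> s) (at s)" if s: "s \<in> V" for s
  proof -
    have "(f has_field_derivative deriv f (\<phi> s)) (at (\<phi> s))"
      using s V S by (intro holomorphic_derivI[of _ S]) auto
    from DERIV_chain2[OF this d\<phi>[OF s]]
    show ?thesis
      by (rule has_field_derivative_transform_within_open[OF _ V(1) s]) (use Q V in auto)
  qed
  then show "deriv g t = deriv f (\<phi> t) * deriv \<phi> t" using V by (auto intro: DERIV_imp_deriv)
  have "(deriv f has_field_derivative deriv (deriv f) (\<phi> t)) (at (\<phi> t))"
    using S by (intro holomorphic_derivI[of _ S] holomorphic_deriv) auto
  from DERIV_chain2[OF this d\<phi>[OF V(2)]]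
  have "((\<lambda>s. deriv f (\<phi> s)) has_field_derivative deriv (deriv f) (\<phi> t) * deriv \<phi> t) (at t)" .
  moreover have "(deriv \<phi> has_field_derivative deriv (deriv \<phi>) t) (at t)"
    using R by (intro holomorphic_derivI[of _ R] holomorphic_deriv) auto
  ultimately have "((\<lambda>s. deriv f (\<phi> s) * deriv \<phi> s) has_field_derivative
      deriv (deriv f) (\<phi> t) * deriv \<phi> t * deriv \<phi> t + deriv (deriv \<phi>) t * deriv f (\<phi> t)) (at t)"
    by (rule DERIV_mult)
  then have "(deriv g has_field_derivative
      deriv (deriv f) (\<phi> t) * deriv \<phi> t * deriv \<phi> t + deriv (deriv \<phi>) t * deriv f (\<phi> t)) (at t)"
    by (rule has_field_derivative_transform_within_open[OF _ V(1,2)]) (simp add: DERIV_imp_deriv[OF dg])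
  then show "deriv (deriv g) t = deriv (deriv f) (\<phi> t) * deriv \<phi> t ^ 2 + deriv f (\<phi> t) * deriv (deriv \<phi>) t"
    by (simp add: DERIV_imp_deriv power2_eq_square mult.commute mult.left_commute)
qed

lemma velocity_reparam:
  assumes "regular_at \<gamma> (\<phi> t)" "\<phi> analytic_on {t}" "\<forall>\<^sub>F s in nhds t. \<delta> s = \<gamma> (\<phi> s)"
  shows "velocity \<delta> t = (fst (velocity \<gamma> (\<phi> t)) * deriv \<phi> t, snd (velocity \<gamma> (\<phi> t)) * deriv \<phi> t)"
proof -
  have "\<forall>\<^sub>F s in nhds t. fst (\<delta> s) = fst (\<gamma> (\<phi> s))" "\<forall>\<^sub>F s in nhds t. snd (\<delta> s) = snd (\<gamma> (\<phi> s))"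
    using assms(3) by (auto elim!: eventually_mono)
  then show ?thesis
    using assms deriv_reparam(1)[of "\<lambda>s. fst (\<gamma> s)" \<phi> t "\<lambda>s. fst (\<delta> s)"]
      deriv_reparam(1)[of "\<lambda>s. snd (\<gamma> s)" \<phi> t "\<lambda>s. snd (\<delta> s)"]
    by (simp add: velocity_def regular_at_def)
qed

text \<open>A new parameter scales the velocity by the derivative of \<phi> and adds to the rescaled
  acceleration a multiple of the velocity, which cancels in \<open>dx * ddu - du * ddx\<close>. Both
  sides acquire the cube of the derivative of \<phi>.\<close>

lemma ode_at_reparam:
  assumes reg: "regular_at \<gamma> (\<phi> t)" and \<phi>: "\<phi> analytic_on {t}" and eq: "\<forall>\<^sub>F s in nhds t. \<delta> s = \<gamma> (\<phi> s)"
    and ode: "ode_at A B C D \<gamma> (\<phi> t)"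
  shows "ode_at A B C D \<delta> t"
proof -
  have ev: "\<forall>\<^sub>F s in nhds t. fst (\<delta> s) = fst (\<gamma> (\<phi> s))" "\<forall>\<^sub>F s in nhds t. snd (\<delta> s) = snd (\<gamma> (\<phi> s))"
    using eq by (auto elim!: eventually_mono)
  have \<delta>t: "\<delta> t = \<gamma> (\<phi> t)" using eventually_nhds_x_imp_x[OF eq] .
  have reg': "(\<lambda>s. fst (\<gamma> s)) analytic_on {\<phi> t}" "(\<lambda>s. snd (\<gamma> s)) analytic_on {\<phi> t}"
    using reg by (auto simp: regular_at_def)
  show ?thesis
    using ode unfolding ode_at_def Let_def \<delta>t deriv_reparam[OF reg'(1) \<phi> ev(1)] deriv_reparam[OF reg'(2) \<phi> ev(2)]
    by algebra
qed

lemma ode_at_graph: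
  "ode_at A B C D (\<lambda>x. (x, f x)) x \<longleftrightarrow> deriv (deriv f) x = cubic_rhs A B C D x (f x) (deriv f x)"
  by (simp add: ode_at_def cubic_rhs_def Let_def)

text \<open>Where \<open>dx\<close> does not vanish, \<open>x\<close> is a local parameter: \<psi>
  inverts the first component of the curve, and \<open>f\<close> is the second component in terms of
  \<open>x\<close>. The clause \<open>\<psi> (fst (\<gamma> s)) = s\<close> is exported because it
  later yields the change of parameter between two curves.\<close>

lemma curve_as_graph:
  assumes \<gamma>: "curve_on U T \<gamma>" and t: "t \<in> T" and nz: "fst (velocity \<gamma> t) \<noteq> 0"
    and ode: "integral_curve A B C D T \<gamma>"
    and ab: "\<gamma> t = (a, b)" and k: "snd (velocity \<gamma> t) / fst (velocity \<gamma> t) = k"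
  obtains e \<psi> f where "e > 0" "\<psi> holomorphic_on ball a e" "\<psi> a = t"
    "\<And>x. x \<in> ball a e \<Longrightarrow> \<gamma> (\<psi> x) = (x, f x)" "\<forall>\<^sub>F s in nhds t. \<psi> (fst (\<gamma> s)) = s"
    "f holomorphic_on ball a e" "f a = b" "deriv f a = k"
    "\<And>x. x \<in> ball a e \<Longrightarrow> deriv (deriv f) x = cubic_rhs A B C D x (f x) (deriv f x)"
proof -
  let ?X = "\<lambda>s. fst (\<gamma> s)" and ?Y = "\<lambda>s. snd (\<gamma> s)"
  have Xt: "?X t = a" using ab by simp
  have T: "open T" "?X holomorphic_on T" "?Y holomorphic_on T" using \<gamma> by (auto simp: curve_on_def)
  obtain r where r: "r > 0" "ball t r \<subseteq> T" "open (?X ` ball t r)" "inj_on ?X (ball t r)"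
    using has_complex_derivative_locally_invertible[OF T(2) t T(1)] nz by (auto simp: velocity_def)
  have holX: "?X holomorphic_on ball t r" using T r holomorphic_on_subset by blast
  obtain \<psi> where \<psi>: "\<psi> holomorphic_on ?X ` ball t r" "\<And>s. s \<in> ball t r \<Longrightarrow> \<psi> (?X s) = s"
    using holomorphic_has_inverse[OF holX open_ball r(4)] by metis
  have "a \<in> ?X ` ball t r" using r Xt by force
  then obtain e where e: "e > 0" "ball a e \<subseteq> ?X ` ball t r" using r(3) open_contains_ball by blast
  have inv: "\<psi> x \<in> ball t r \<and> ?X (\<psi> x) = x" if "x \<in> ball a e" for x
    using e(2) that \<psi>(2) by force
  define f where "f x = ?Y (\<psi> x)" for x
  have hol\<psi>: "\<psi> holomorphic_on ball a e" using \<psi>(1) e(2) holomorphic_on_subset by blast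
  have \<psi>t: "\<psi> a = t" using \<psi>(2)[of t] r Xt by simp
  have graph: "\<gamma> (\<psi> x) = (x, f x)" if "x \<in> ball a e" for x
    using inv[OF that] by (simp add: f_def prod_eq_iff)
  have "?Y \<circ> \<psi> holomorphic_on ball a e"
    using hol\<psi> T(3) by (rule holomorphic_on_compose_gen) (use inv r in blast)
  then have holf: "f holomorphic_on ball a e" by (simp add: f_def[abs_def] o_def)
  have loc: "regular_at \<gamma> (\<psi> x)" "\<psi> analytic_on {x}" "\<forall>\<^sub>F z in nhds x. (z, f z) = \<gamma> (\<psi> z)"
    if x: "x \<in> ball a e" for x
  proof -
    show "regular_at \<gamma> (\<psi> x)" using inv[OF x] r curve_on_regular[OF \<gamma>] by blast
    show "\<psi> analytic_on {x}" using hol\<psi> x unfolding analytic_at by blast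
    show "\<forall>\<^sub>F z in nhds x. (z, f z) = \<gamma> (\<psi> z)"
      using eventually_nhds_in_open[OF open_ball x] by eventually_elim (simp add: graph)
  qed
  have xt: "a \<in> ball a e" using e by simp
  have "velocity (\<lambda>x. (x, f x)) a =
     (fst (velocity \<gamma> t) * deriv \<psi> a, snd (velocity \<gamma> t) * deriv \<psi> a)"
    using velocity_reparam[OF loc[OF xt]] by (simp add: \<psi>t)
  then have "1 = fst (velocity \<gamma> t) * deriv \<psi> a" "deriv f a = snd (velocity \<gamma> t) * deriv \<psi> a"
    by (auto simp: velocity_def[of "\<lambda>x. (x, f x)"])
  then have df: "deriv f a = k"
    using nz unfolding k[symmetric] by (simp add: field_simps)
  show thesis
  proof (rule that[OF e(1) hol\<psi> \<psi>t graph _ holf _ df])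
    have "t \<in> ball t r" using r by simp
    from eventually_nhds_in_open[OF open_ball this]
    show "\<forall>\<^sub>F s in nhds t. \<psi> (?X s) = s" by eventually_elim (rule \<psi>(2))
    show "f a = b" by (simp add: f_def \<psi>t ab)
    show "deriv (deriv f) x = cubic_rhs A B C D x (f x) (deriv f x)" if x: "x \<in> ball a e" for x
    proof -
      have "ode_at A B C D \<gamma> (\<psi> x)" using ode inv[OF x] r unfolding integral_curve_iff by blast
      from ode_at_reparam[OF loc[OF x] this] show ?thesis by (simp add: ode_at_graph)
    qed
  qed
qed

text \<open>Both curves are graphs near \<open>a\<close>; equal point and direction give them the
  same value and slope there, so the graphs coincide by uniqueness.\<close>

lemma same_germ_nonvertical:
  assumes U: "open U" and h: "holo2_on A U" "holo2_on B U" "holo2_on C U" "holo2_on D U"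
    and c1: "curve_on U T1 \<gamma>1" "t1 \<in> T1" "integral_curve A B C D T1 \<gamma>1"
    and c2: "curve_on U T2 \<gamma>2" "t2 \<in> T2" "integral_curve A B C D T2 \<gamma>2"
    and eq: "\<gamma>1 t1 = \<gamma>2 t2" and dir: "same_direction (velocity \<gamma>1 t1) (velocity \<gamma>2 t2)"
    and nz: "fst (velocity \<gamma>1 t1) \<noteq> 0"
  shows "same_germ \<gamma>1 t1 \<gamma>2 t2"
proof -
  obtain a b where ab: "\<gamma>1 t1 = (a, b)" by fastforce
  have ab2: "\<gamma>2 t2 = (a, b)" using eq ab by simp
  have abU: "(a, b) \<in> U" using c1 ab by (metis curve_on_def)
  define k where "k = snd (velocity \<gamma>1 t1) / fst (velocity \<gamma>1 t1)"
  obtain c where c: "c \<noteq> 0" "velocity \<gamma>2 t2 = (c * fst (velocity \<gamma>1 t1), c * snd (velocity \<gamma>1 t1))"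
    using dir by (auto simp: same_direction_def)
  have nz2: "fst (velocity \<gamma>2 t2) \<noteq> 0" and k2: "snd (velocity \<gamma>2 t2) / fst (velocity \<gamma>2 t2) = k"
    using c nz by (auto simp: k_def)
  obtain e1 \<psi>1 f1 where 1: "e1 > 0" "\<psi>1 holomorphic_on ball a e1" "\<psi>1 a = t1"
    "\<And>x. x \<in> ball a e1 \<Longrightarrow> \<gamma>1 (\<psi>1 x) = (x, f1 x)" "\<forall>\<^sub>F s in nhds t1. \<psi>1 (fst (\<gamma>1 s)) = s"
    "f1 holomorphic_on ball a e1" "f1 a = b" "deriv f1 a = k"
    "\<And>x. x \<in> ball a e1 \<Longrightarrow> deriv (deriv f1) x = cubic_rhs A B C D x (f1 x) (deriv f1 x)"
    by (rule curve_as_graph[OF c1(1,2) nz c1(3) ab k_def[symmetric]]) blast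
  obtain e2 \<psi>2 f2 where 2: "e2 > 0" "\<psi>2 holomorphic_on ball a e2" "\<psi>2 a = t2"
    "\<And>x. x \<in> ball a e2 \<Longrightarrow> \<gamma>2 (\<psi>2 x) = (x, f2 x)" "\<forall>\<^sub>F s in nhds t2. \<psi>2 (fst (\<gamma>2 s)) = s"
    "f2 holomorphic_on ball a e2" "f2 a = b" "deriv f2 a = k"
    "\<And>x. x \<in> ball a e2 \<Longrightarrow> deriv (deriv f2) x = cubic_rhs A B C D x (f2 x) (deriv f2 x)"
    by (rule curve_as_graph[OF c2(1,2) nz2 c2(3) ab2 k2]) blast
  define e where "e = min e1 e2"
  have e: "e > 0" "ball a e \<subseteq> ball a e1" "ball a e \<subseteq> ball a e2" using 1(1) 2(1) by (auto simp: e_def)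
  obtain r L M where "ode2 (cubic_rhs A B C D) a b k r L M" using cubic_rhs_ode2[OF U h abU] by metis
  then interpret ode2 "cubic_rhs A B C D" a b k r L M .
  obtain s where s: "s > 0" "\<And>x. x \<in> ball a s \<Longrightarrow> f1 x = f2 x"
  proof (rule solution_unique[OF e(1), of f1 f2])
    show "f1 holomorphic_on ball a e" "f2 holomorphic_on ball a e"
      using 1(6) 2(6) e holomorphic_on_subset by blast+
  qed (use 1 2 e in auto)
  let ?X = "\<lambda>s. fst (\<gamma>1 s)"
  have X: "?X analytic_on {t1}" using curve_on_regular[OF c1(1,2)] by (simp add: regular_at_def)
  have "\<psi>2 analytic_on {?X t1}" using 2(1,2) ab unfolding analytic_at by (auto intro!: exI[of _ "ball a e2"])
  \<comment> \<open>The change of parameter: from the first curve to its abscissa, then to the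
    parameter at which the second curve has this abscissa.\<close>
  with X have an: "\<psi>2 \<circ> ?X analytic_on {t1}" by (intro analytic_on_compose) auto
  define d where "d = min s e"
  have "isCont ?X t1" using X by (rule analytic_at_imp_isCont)
  then have "(?X \<longlongrightarrow> ?X t1) (nhds t1)" unfolding isCont_def by (rule tendsto_at_iff_tendsto_nhds[THEN iffD1])
  then have "(?X \<longlongrightarrow> a) (nhds t1)" by (simp only: ab fst_conv)
  then have "\<forall>\<^sub>F t in nhds t1. ?X t \<in> ball a d"
    by (rule topological_tendstoD) (use s e in \<open>auto simp: d_def\<close>)
  with 1(5) have "\<forall>\<^sub>F t in nhds t1. \<gamma>1 t = \<gamma>2 ((\<psi>2 \<circ> ?X) t)"
  proof eventually_elim
    case (elim t)
    then have x: "?X t \<in> ball a s" "?X t \<in> ball a e1" "?X t \<in> ball a e2" using e by (auto simp: d_def)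
    have "\<gamma>1 t = (?X t, f1 (?X t))" using 1(4)[OF x(2)] elim by simp
    then show ?case using 2(4)[OF x(3)] s(2)[OF x(1)] by simp
  qed
  then show ?thesis using an 2(3) ab by (auto simp: same_germ_def intro!: exI[of _ "\<psi>2 \<circ> ?X"])
qed

lemma integral_curves_same_germ:
  assumes U: "open U" and h: "holo2_on A U" "holo2_on B U" "holo2_on C U" "holo2_on D U"
    and c1: "curve_on U T1 \<gamma>1" "t1 \<in> T1" "integral_curve A B C D T1 \<gamma>1"
    and c2: "curve_on U T2 \<gamma>2" "t2 \<in> T2" "integral_curve A B C D T2 \<gamma>2"
    and eq: "\<gamma>1 t1 = \<gamma>2 t2" and dir: "same_direction (velocity \<gamma>1 t1) (velocity \<gamma>2 t2)"
  shows "same_germ \<gamma>1 t1 \<gamma>2 t2"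
proof (cases "fst (velocity \<gamma>1 t1) = 0")
  case False
  then show ?thesis using same_germ_nonvertical assms by blast
next
  case True
  \<comment> \<open>Vertical tangent: exchanging the coordinates makes the first velocity component
    nonzero.\<close>
  let ?\<gamma>1 = "\<lambda>t. prod.swap (\<gamma>1 t)" and ?\<gamma>2 = "\<lambda>t. prod.swap (\<gamma>2 t)"
  have "velocity \<gamma>1 t1 \<noteq> (0, 0)" using c1 by (auto simp: curve_on_def)
  with True have nz: "fst (velocity ?\<gamma>1 t1) \<noteq> 0" by (simp add: velocity_def)
  have "same_germ ?\<gamma>1 t1 ?\<gamma>2 t2"
    by (rule same_germ_nonvertical[OF open_swap[OF U] holo2_neg_swap[OF U h(4)] holo2_neg_swap[OF U h(3)]
          holo2_neg_swap[OF U h(2)] holo2_neg_swap[OF U h(1)] curve_on_swap[OF c1(1)] c1(2) _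
          curve_on_swap[OF c2(1)] c2(2) _ _ _ nz])
       (use c1(3) c2(3) eq dir in \<open>simp_all only: integral_curve_swap same_direction_swap\<close>)
  then show ?thesis by (simp only: same_germ_swap)
qed

section \<open>Existence of integral curves in every tangent direction\<close>

lemma integral_curve_exists_nonvertical:
  assumes U: "open U" and h: "holo2_on A U" "holo2_on B U" "holo2_on C U" "holo2_on D U"
    and p: "p \<in> U" and d: "fst d \<noteq> 0"
  shows "\<exists>T \<gamma>. curve_on U T \<gamma> \<and> integral_curve A B C D T \<gamma> \<and>
           (\<exists>t\<in>T. \<gamma> t = p \<and> same_direction d (velocity \<gamma> t))"
proof -
  obtain a b where ab: "p = (a, b)" by fastforce
  obtain r L M where "ode2 (cubic_rhs A B C D) a b (snd d / fst d) r L M" and sub: "cball a r \<times> cball b r \<subseteq> U"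
    using cubic_rhs_ode2[OF U h, of a b "snd d / fst d"] p ab by blast
  then interpret ode2 "cubic_rhs A B C D" a b "snd d / fst d" r L M by simp
  obtain s f where f: "s > 0" "s \<le> r" "f holomorphic_on ball a s" "f ` ball a s \<subseteq> ball b r"
    "f a = b" "deriv f a = snd d / fst d"
    "\<And>x. x \<in> ball a s \<Longrightarrow> deriv (deriv f) x = cubic_rhs A B C D x (f x) (deriv f x)"
    by (rule solution_exists) blast
  let ?\<gamma> = "\<lambda>x. (x, f x)"
  have vel: "velocity ?\<gamma> x = (1, deriv f x)" for x by (simp add: velocity_def)
  have "(x, f x) \<in> U" if "x \<in> ball a s" for x using that f(2,4) sub by fastforce
  then have "curve_on U (ball a s) ?\<gamma>"
    using f(1,3) by (auto simp: curve_on_def vel)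
  moreover have "integral_curve A B C D (ball a s) ?\<gamma>"
    using f(7) by (simp add: integral_curve_iff ode_at_graph)
  \<comment> \<open>The graph has velocity \<open>(1, snd d / fst d)\<close> at \<open>a\<close>,
    that is, \<open>d\<close> divided by \<open>fst d\<close>.\<close>
  moreover have "same_direction d (velocity ?\<gamma> a)"
    using d f(6) by (auto simp: same_direction_def vel intro!: exI[of _ "1 / fst d"])
  ultimately show ?thesis using f(1,5) ab by (intro exI[of _ "ball a s"] exI[of _ ?\<gamma>]) auto
qed

lemma integral_curve_exists:
  assumes U: "open U" and h: "holo2_on A U" "holo2_on B U" "holo2_on C U" "holo2_on D U"
    and p: "p \<in> U" and d: "d \<noteq> (0, 0)"
  shows "\<exists>T \<gamma>. curve_on U T \<gamma> \<and> integral_curve A B C D T \<gamma> \<and>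
           (\<exists>t\<in>T. \<gamma> t = p \<and> same_direction d (velocity \<gamma> t))"
proof (cases "fst d = 0")
  case False
  then show ?thesis using integral_curve_exists_nonvertical[OF U h p] by blast
next
  case True
  \<comment> \<open>A vertical direction is no longer vertical after the exchange; the curve found
    there is carried back.\<close>
  have "fst (prod.swap d) \<noteq> 0" using True d by (cases d) auto
  moreover have "prod.swap p \<in> prod.swap ` U" using p by blast
  ultimately obtain T \<gamma> t where g: "curve_on (prod.swap ` U) T \<gamma>"
      "integral_curve (neg_swap D) (neg_swap C) (neg_swap B) (neg_swap A) T \<gamma>"
      "t \<in> T" "\<gamma> t = prod.swap p" "same_direction (prod.swap d) (velocity \<gamma> t)"
    using integral_curve_exists_nonvertical[OF open_swap[OF U] holo2_neg_swap[OF U h(4)]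
        holo2_neg_swap[OF U h(3)] holo2_neg_swap[OF U h(2)] holo2_neg_swap[OF U h(1)]] by blast
  let ?\<gamma> = "\<lambda>t. prod.swap (\<gamma> t)"
  have "curve_on U T ?\<gamma>" using curve_on_swap[OF g(1)] by (simp add: image_image)
  moreover have "integral_curve A B C D T ?\<gamma>"
    using g(2) integral_curve_swap[of D C B A T ?\<gamma>] by simp
  moreover have "?\<gamma> t = p" using g(4) by simp
  moreover have "same_direction d (velocity ?\<gamma> t)"
    using g(5) by (auto simp: same_direction_def velocity_def)
  ultimately show ?thesis using g(3) by blast
qed

text \<open>It is enough that the members of \<Gamma> solve the equation. An arbitrary integral
  curve shares point and direction with some member, hence also the germ; conversely, a curve with
  germs from \<Gamma> inherits the equation by invariance under change of parameter.\<close>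

lemma represents_if_integral:
  assumes U: "open U" and h: "holo2_on A U" "holo2_on B U" "holo2_on C U" "holo2_on D U"
    and \<Gamma>: "two_param_system U \<Gamma>" and int: "\<And>T \<gamma>. (T, \<gamma>) \<in> \<Gamma> \<Longrightarrow> integral_curve A B C D T \<gamma>"
  shows "represents U A B C D \<Gamma>"
  unfolding represents_def
proof (intro allI impI iffI)
  fix T \<gamma> assume c: "curve_on U T \<gamma>"
  have cu: "curve_on U T' \<gamma>'" if "(T', \<gamma>') \<in> \<Gamma>" for T' \<gamma>'
    using \<Gamma> that by (auto simp: two_param_system_def)
  {
    assume i: "integral_curve A B C D T \<gamma>"
    show "\<forall>t\<in>T. \<exists>(T', \<gamma>')\<in>\<Gamma>. \<exists>t'\<in>T'. same_germ \<gamma> t \<gamma>' t'"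
    proof
      fix t assume t: "t \<in> T"
      have "\<gamma> t \<in> U" "velocity \<gamma> t \<noteq> (0, 0)" using c t by (auto simp: curve_on_def)
      then have "\<exists>(T', \<gamma>')\<in>\<Gamma>. \<exists>t'\<in>T'. \<gamma>' t' = \<gamma> t \<and> same_direction (velocity \<gamma> t) (velocity \<gamma>' t')"
        using \<Gamma> unfolding two_param_system_def by blast
      then obtain T' \<gamma>' t' where g: "(T', \<gamma>') \<in> \<Gamma>" "t' \<in> T'" "\<gamma>' t' = \<gamma> t"
          "same_direction (velocity \<gamma> t) (velocity \<gamma>' t')" by blast
      have "same_germ \<gamma> t \<gamma>' t'"
        by (rule integral_curves_same_germ[OF U h c t i cu[OF g(1)] g(2) int[OF g(1)] g(3)[symmetric] g(4)])
      with g show "\<exists>(T', \<gamma>')\<in>\<Gamma>. \<exists>t'\<in>T'. same_germ \<gamma> t \<gamma>' t'" by blast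
    qed
  next
    assume l: "\<forall>t\<in>T. \<exists>(T', \<gamma>')\<in>\<Gamma>. \<exists>t'\<in>T'. same_germ \<gamma> t \<gamma>' t'"
    show "integral_curve A B C D T \<gamma>"
      unfolding integral_curve_iff
    proof
      fix t assume "t \<in> T"
      with l obtain T' \<gamma>' \<phi> where g: "(T', \<gamma>') \<in> \<Gamma>" "\<phi> t \<in> T'" "\<phi> analytic_on {t}"
          "\<forall>\<^sub>F s in nhds t. \<gamma> s = \<gamma>' (\<phi> s)"
        unfolding same_germ_def by blast
      show "ode_at A B C D \<gamma> t"
        using ode_at_reparam[OF curve_on_regular[OF cu[OF g(1)] g(2)] g(3,4)] int[OF g(1)] g(2)
        by (simp add: integral_curve_iff)
    qed
  }
qed

lemma integral_curves_two_param:
  assumes U: "open U" and h: "holo2_on A U" "holo2_on B U" "holo2_on C U" "holo2_on D U"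
  shows "two_param_system U {(T, \<gamma>). curve_on U T \<gamma> \<and> integral_curve A B C D T \<gamma>}"
  unfolding two_param_system_def
proof (intro conjI)
  show "\<forall>p\<in>U. \<forall>d. d \<noteq> (0, 0) \<longrightarrow> (\<exists>(T, \<gamma>)\<in>{(T, \<gamma>). curve_on U T \<gamma> \<and> integral_curve A B C D T \<gamma>}.
      \<exists>t\<in>T. \<gamma> t = p \<and> same_direction d (velocity \<gamma> t))"
    using integral_curve_exists[OF U h] by blast
qed (use integral_curves_same_germ[OF U h] in blast)+


subsection \<open>Linear algebra of the second osculating space\<close>

text \<open>\<open>vec.independent\<close> concerns a set and forgets repetitions; injectivity
  restores the family. The coefficient form serves to compare coordinates and to handle matrix
  columns.\<close>

lemma independent_family_iff:
  fixes v :: "'i \<Rightarrow> complex ^ 'n"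
  assumes I: "finite I"
  shows "inj_on v I \<and> vec.independent (v ` I) \<longleftrightarrow>
    (\<forall>c. (\<Sum>i\<in>I. c i *s v i) = 0 \<longrightarrow> (\<forall>i\<in>I. c i = 0))"
proof safe
  fix c i assume inj: "inj_on v I" and ind: "vec.independent (v ` I)"
    and 0: "(\<Sum>i\<in>I. c i *s v i) = 0" and i: "i \<in> I"
  have "(\<Sum>x\<in>v ` I. c (the_inv_into I v x) *s x) = (\<Sum>i\<in>I. c i *s v i)"
    using inj by (simp add: sum.reindex the_inv_into_f_f)
  then have "c (the_inv_into I v (v i)) = 0"
    using ind I i 0 by (auto simp: vec.dependent_finite)
  then show "c i = 0" using inj i by (simp add: the_inv_into_f_f)
next
  assume *: "\<forall>c. (\<Sum>i\<in>I. c i *s v i) = 0 \<longrightarrow> (\<forall>i\<in>I. c i = 0)"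
  show inj: "inj_on v I"
  proof (rule inj_onI, rule ccontr)
    fix i j assume ij: "i \<in> I" "j \<in> I" "v i = v j" "i \<noteq> j"
    let ?c = "\<lambda>k. (if k = i then 1 else 0) - (if k = j then 1 else 0) :: complex"
    have "(\<Sum>k\<in>I. ?c k *s v k) = (\<Sum>k\<in>I. (if k = i then v k else 0) - (if k = j then v k else 0))"
      by (intro sum.cong) (auto simp: vec_eq_iff)
    also have "\<dots> = v i - v j" using I ij by (simp add: sum_subtractf)
    finally have "(\<Sum>k\<in>I. ?c k *s v k) = 0" using ij by simp
    then have "?c i = 0" using *[rule_format, of ?c i] ij by blast
    then show False using ij by simp
  qed
  assume "vec.dependent (v ` I)"
  then obtain u where u: "\<exists>x\<in>v ` I. u x \<noteq> 0" "(\<Sum>x\<in>v ` I. u x *s x) = 0"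
    using I by (auto simp: vec.dependent_finite)
  have "(\<Sum>i\<in>I. u (v i) *s v i) = 0" using u(2) inj by (simp add: sum.reindex)
  with * u(1) show False by fastforce
qed

lemma span1: "x \<in> vec.span {a} \<longleftrightarrow> (\<exists>k. x = k *s a)" for a :: "complex ^ 'n"
  by (auto simp: vec.span_breakdown_eq)

lemma span2: "x \<in> vec.span {a, b} \<longleftrightarrow> (\<exists>k l. x = k *s a + l *s b)" for a :: "complex ^ 'n"
  by (simp add: vec.span_breakdown_eq algebra_simps)

lemma span3: "x \<in> vec.span {a, b, c} \<longleftrightarrow> (\<exists>k l m. x = k *s a + l *s b + m *s c)" for a :: "complex ^ 'n"
  by (simp add: vec.span_breakdown_eq algebra_simps)

lemma span4: "x \<in> vec.span {a, b, c, d} \<longleftrightarrow> (\<exists>k l m n. x = k *s a + l *s b + m *s c + n *s d)"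
  for a :: "complex ^ 'n"
  by (simp add: vec.span_breakdown_eq algebra_simps)

lemma card_four: "a \<notin> {b, c, d} \<Longrightarrow> b \<notin> {c, d} \<Longrightarrow> c \<notin> {d} \<Longrightarrow> card {a, b, c, d} = 4"
  by simp

text \<open>Stands for \<open>y\<close>, \<open>y_x\<close>, \<open>y_u\<close>,
  \<open>y_xx\<close>, \<open>y_xu\<close>, \<open>y_uu\<close> at one point, in this order. The six
  vectors span S(2,0), not necessarily the ambient space.\<close>

locale frame6 =
  fixes e0 e1 e2 e3 e4 e5 :: "complex ^ 'n"
  assumes distinct: "distinct [e0, e1, e2, e3, e4, e5]"
    and independent: "vec.independent (set [e0, e1, e2, e3, e4, e5])"
begin

lemma coeffs_zero:
  assumes "k0 *s e0 + k1 *s e1 + k2 *s e2 + k3 *s e3 + k4 *s e4 + k5 *s e5 = 0"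
  shows "k0 = 0 \<and> k1 = 0 \<and> k2 = 0 \<and> k3 = 0 \<and> k4 = 0 \<and> k5 = 0"
proof -
  let ?E = "[e0, e1, e2, e3, e4, e5]" and ?K = "[k0, k1, k2, k3, k4, k5]"
  have im: "(!) ?E ` {..<6} = set ?E"
    by (auto simp: set_conv_nth numeral_eq_Suc less_Suc_eq image_iff)
  have "inj_on ((!) ?E) {..<6} \<and> vec.independent ((!) ?E ` {..<6})"
    using distinct independent unfolding im by (auto simp: inj_on_def nth_eq_iff_index_eq simp del: distinct.simps)
  then have "\<forall>i\<in>{..<6}. ?K ! i = 0"
    unfolding independent_family_iff[OF finite_lessThan]
    using assms by (elim allE[of _ "(!) ?K"]) (auto simp: numeral_eq_Suc algebra_simps)
  then have "?K ! i = 0" if "i < 6" for i using that by blast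
  from this[of 0] this[of 1] this[of 2] this[of 3] this[of 4] this[of 5] show ?thesis by simp
qed

lemma coeffs_eq:
  assumes "k0 *s e0 + k1 *s e1 + k2 *s e2 + k3 *s e3 + k4 *s e4 + k5 *s e5 =
    l0 *s e0 + l1 *s e1 + l2 *s e2 + l3 *s e3 + l4 *s e4 + l5 *s e5"
  shows "k0 = l0 \<and> k1 = l1 \<and> k2 = l2 \<and> k3 = l3 \<and> k4 = l4 \<and> k5 = l5"
proof -
  have "(k0 - l0) *s e0 + (k1 - l1) *s e1 + (k2 - l2) *s e2 + (k3 - l3) *s e3 + (k4 - l4) *s e4
      + (k5 - l5) *s e5 = 0"
    using assms by (simp add: vec_eq_iff algebra_simps)
  from coeffs_zero[OF this] show ?thesis by simp
qed

definition cospace where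
  "cospace p1 q1 p2 q2 p3 q3 = vec.span {e0, e3 + p1 *s e1 + q1 *s e2, e4 + p2 *s e1 + q2 *s e2,
     e5 + p3 *s e1 + q3 *s e2}"

lemma cospace_iff:
  "x \<in> cospace p1 q1 p2 q2 p3 q3 \<longleftrightarrow> (\<exists>k0 k3 k4 k5.
     x = k0 *s e0 + (k3 * p1 + k4 * p2 + k5 * p3) *s e1 + (k3 * q1 + k4 * q2 + k5 * q3) *s e2
       + k3 *s e3 + k4 *s e4 + k5 *s e5)"
  unfolding cospace_def span4 by (intro ex_cong1 arg_cong[of _ _ "(=) x"]) (simp add: vec_eq_iff algebra_simps)

lemma e0_nz: "e0 \<noteq> 0"
  using coeffs_zero[of 1 0 0 0 0 0] by auto

text \<open>Triangular shape: going through the list backwards, each vector has coefficient 1 at one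
  of \<open>e5\<close>, \<open>e4\<close>, \<open>e3\<close>, \<open>e0\<close>, where all vectors
  treated before it have 0.\<close>

lemma cospace_basis:
  "card {e0, e3 + p1 *s e1 + q1 *s e2, e4 + p2 *s e1 + q2 *s e2, e5 + p3 *s e1 + q3 *s e2} = 4 \<and>
   vec.independent {e0, e3 + p1 *s e1 + q1 *s e2, e4 + p2 *s e1 + q2 *s e2, e5 + p3 *s e1 + q3 *s e2}"
proof -
  let ?w1 = "e3 + p1 *s e1 + q1 *s e2" and ?w2 = "e4 + p2 *s e1 + q2 *s e2" and ?w3 = "e5 + p3 *s e1 + q3 *s e2"
  have 3: "?w3 \<notin> vec.span {}"
  proof
    assume "?w3 \<in> vec.span {}"
    then have "0 *s e0 + p3 *s e1 + q3 *s e2 + 0 *s e3 + 0 *s e4 + 1 *s e5 = 0"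
      by (simp add: vec_eq_iff algebra_simps)
    from coeffs_zero[OF this] show False by simp
  qed
  have 2: "?w2 \<notin> vec.span {?w3}"
  proof
    assume "?w2 \<in> vec.span {?w3}"
    then obtain k where "?w2 = k *s ?w3" unfolding span1 by blast
    then have "0 *s e0 + (p2 - k * p3) *s e1 + (q2 - k * q3) *s e2 + 0 *s e3 + 1 *s e4 + (- k) *s e5 = 0"
      by (simp add: vec_eq_iff algebra_simps)
    from coeffs_zero[OF this] show False by simp
  qed
  have 1: "?w1 \<notin> vec.span {?w2, ?w3}"
  proof
    assume "?w1 \<in> vec.span {?w2, ?w3}"
    then obtain k l where "?w1 = k *s ?w2 + l *s ?w3" unfolding span2 by blast
    then have "0 *s e0 + (p1 - k * p2 - l * p3) *s e1 + (q1 - k * q2 - l * q3) *s e2 + 1 *s e3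
        + (- k) *s e4 + (- l) *s e5 = 0"
      by (simp add: vec_eq_iff algebra_simps)
    from coeffs_zero[OF this] show False by simp
  qed
  have 0: "e0 \<notin> vec.span {?w1, ?w2, ?w3}"
  proof
    assume "e0 \<in> vec.span {?w1, ?w2, ?w3}"
    then obtain j k l where "e0 = j *s ?w1 + k *s ?w2 + l *s ?w3" unfolding span3 by blast
    then have "(-1) *s e0 + (j * p1 + k * p2 + l * p3) *s e1 + (j * q1 + k * q2 + l * q3) *s e2 + j *s e3
        + k *s e4 + l *s e5 = 0"
      by (simp add: vec_eq_iff algebra_simps)
    from coeffs_zero[OF this] show False by simp
  qed
  have "vec.independent {e0, ?w1, ?w2, ?w3}"
    by (intro vec.independent_insertI 0 1 2 3 vec.independent_empty)
  moreover have "e0 \<notin> {?w1, ?w2, ?w3}" "?w1 \<notin> {?w2, ?w3}" "?w2 \<notin> {?w3}"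
    by (rule contrapos_nn[OF 0 vec.span_base] contrapos_nn[OF 1 vec.span_base] contrapos_nn[OF 2 vec.span_base]; assumption)+
  then have "card {e0, ?w1, ?w2, ?w3} = 4" by (rule card_four)
  ultimately show ?thesis by blast
qed

lemma proj_space_cospace: "proj_space 3 (cospace p1 q1 p2 q2 p3 q3)"
  using cospace_basis[of p1 q1 p2 q2 p3 q3]
  by (simp add: proj_space_def cospace_def vec.dim_eq_card_independent)

text \<open>In an element of the three-space the coefficients of \<open>e3\<close>,
  \<open>e4\<close>, \<open>e5\<close> determine those of \<open>e1\<close> and \<open>e2\<close>;
  in the tangent plane the former vanish.\<close>

lemma cospace_tangent: "cospace p1 q1 p2 q2 p3 q3 \<inter> vec.span {e0, e1, e2} = vec.span {e0}"
proof
  show "cospace p1 q1 p2 q2 p3 q3 \<inter> vec.span {e0, e1, e2} \<subseteq> vec.span {e0}"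
  proof
    fix x assume "x \<in> cospace p1 q1 p2 q2 p3 q3 \<inter> vec.span {e0, e1, e2}"
    then obtain k0 k3 k4 k5 l0 l1 l2 where
      k: "x = k0 *s e0 + (k3 * p1 + k4 * p2 + k5 * p3) *s e1 + (k3 * q1 + k4 * q2 + k5 * q3) *s e2
       + k3 *s e3 + k4 *s e4 + k5 *s e5" and "x = l0 *s e0 + l1 *s e1 + l2 *s e2"
      unfolding Int_iff cospace_iff span3 by blast
    then have "k0 *s e0 + (k3 * p1 + k4 * p2 + k5 * p3) *s e1 + (k3 * q1 + k4 * q2 + k5 * q3) *s e2
       + k3 *s e3 + k4 *s e4 + k5 *s e5 = l0 *s e0 + l1 *s e1 + l2 *s e2 + 0 *s e3 + 0 *s e4 + 0 *s e5"
      by simp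
    from coeffs_eq[OF this] k have "x = k0 *s e0" by simp
    then show "x \<in> vec.span {e0}" unfolding span1 by blast
  qed
  show "vec.span {e0} \<subseteq> cospace p1 q1 p2 q2 p3 q3 \<inter> vec.span {e0, e1, e2}"
    unfolding cospace_def by (intro Int_greatest vec.span_mono) auto
qed

text \<open>Here \<open>(a, b)\<close> is the velocity and \<open>(a2, b2)\<close> the acceleration
  in the parameter plane. The combination \<open>k *s e0 + l *s (a *s e1 + b *s e2) + m *s g\<close>
  lies in the three-space exactly if \<open>l (a, b) + m (a2 - P, b2 - Q) = 0\<close>. As
  \<open>(a, b)\<close> is not zero, the intersection exceeds the point \<open>e0\<close> exactly if
  some solution has nonzero \<open>m\<close>, and it is then a line.\<close>

lemma osc_cospace_dim:
  assumes nz: "a \<noteq> 0 \<or> b \<noteq> 0"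
    and g: "g = a2 *s e1 + b2 *s e2 + (a ^ 2) *s e3 + (2 * a * b) *s e4 + (b ^ 2) *s e5"
  shows "proj_space 1 (vec.span {e0, a *s e1 + b *s e2, g} \<inter> cospace p1 q1 p2 q2 p3 q3) \<longleftrightarrow>
    a * b2 - b * a2 = q1 * a ^ 3 + (2 * q2 - p1) * a ^ 2 * b + (q3 - 2 * p2) * a * b ^ 2 + (- p3) * b ^ 3"
    (is "proj_space 1 (?osc \<inter> ?\<Omega>) \<longleftrightarrow> ?eq")
proof -
  \<comment> \<open>\<open>P *s e1 + Q *s e2\<close> is what has to be added to the second-order
    part of \<open>g\<close> to land in the three-space.\<close>
  define P where "P = a ^ 2 * p1 + 2 * a * b * p2 + b ^ 2 * p3"
  define Q where "Q = a ^ 2 * q1 + 2 * a * b * q2 + b ^ 2 * q3"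
  have eq_iff: "?eq \<longleftrightarrow> a * (b2 - Q) = b * (a2 - P)"
    unfolding P_def Q_def by algebra
  have meet: "\<exists>k l m. x = k *s e0 + l *s (a *s e1 + b *s e2) + m *s g \<and> l * a + m * (a2 - P) = 0 \<and> l * b + m * (b2 - Q) = 0"
    if x: "x \<in> ?osc \<inter> ?\<Omega>" for x
  proof -
    from x obtain k l m k0 k3 k4 k5 where 1: "x = k *s e0 + l *s (a *s e1 + b *s e2) + m *s g"
      and "x = k0 *s e0 + (k3 * p1 + k4 * p2 + k5 * p3) *s e1 + (k3 * q1 + k4 * q2 + k5 * q3) *s e2
       + k3 *s e3 + k4 *s e4 + k5 *s e5"
      unfolding Int_iff span3 cospace_iff by blast
    then have "k *s e0 + (l * a + m * a2) *s e1 + (l * b + m * b2) *s e2 + (m * a ^ 2) *s e3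
        + (m * (2 * a * b)) *s e4 + (m * b ^ 2) *s e5
      = k0 *s e0 + (k3 * p1 + k4 * p2 + k5 * p3) *s e1 + (k3 * q1 + k4 * q2 + k5 * q3) *s e2
       + k3 *s e3 + k4 *s e4 + k5 *s e5"
      unfolding g by (simp add: vec_eq_iff algebra_simps)
    from coeffs_eq[OF this] have c: "l * a + m * a2 = k3 * p1 + k4 * p2 + k5 * p3"
      "l * b + m * b2 = k3 * q1 + k4 * q2 + k5 * q3" "m * a ^ 2 = k3" "m * (2 * a * b) = k4" "m * b ^ 2 = k5"
      by blast+
    have "l * a + m * (a2 - P) = 0" using c(1) unfolding P_def c(3-5)[symmetric] by algebra
    moreover have "l * b + m * (b2 - Q) = 0" using c(2) unfolding Q_def c(3-5)[symmetric] by algebra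
    ultimately show ?thesis using 1 by blast
  qed
  have sub: "vec.subspace (?osc \<inter> ?\<Omega>)"
    unfolding cospace_def by (intro vec.subspace_inter vec.subspace_span)
  show ?thesis unfolding eq_iff
  proof
    assume "proj_space 1 (?osc \<inter> ?\<Omega>)"
    then have dim: "vec.dim (?osc \<inter> ?\<Omega>) = 2" by (simp add: proj_space_def)
    have "\<not> ?osc \<inter> ?\<Omega> \<subseteq> vec.span {e0}"
      using vec.dim_le_card[of "?osc \<inter> ?\<Omega>" "{e0}"] dim by auto
    then obtain x where x: "x \<in> ?osc \<inter> ?\<Omega>" "x \<notin> vec.span {e0}" by blast
    from meet[OF x(1)] obtain k l m where klm: "x = k *s e0 + l *s (a *s e1 + b *s e2) + m *s g"
      "l * a + m * (a2 - P) = 0" "l * b + m * (b2 - Q) = 0" by blast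
    have "m \<noteq> 0"
    proof
      assume "m = 0"
      with klm(2,3) nz have "l = 0" by auto
      with \<open>m = 0\<close> klm(1) x(2) show False by (auto simp: span1)
    qed
    have "m * (a * (b2 - Q) - b * (a2 - P)) = 0" using klm(2,3) by algebra
    with \<open>m \<noteq> 0\<close> show "a * (b2 - Q) = b * (a2 - P)" by simp
  next
    assume eq: "a * (b2 - Q) = b * (a2 - P)"
    \<comment> \<open>The factor of proportionality, read off from a nonzero component of the
      velocity; \<open>h\<close> below is the second point spanning the line.\<close>
    define r where "r = (if a \<noteq> 0 then (a2 - P) / a else (b2 - Q) / b)"
    have r: "r * a = a2 - P" "r * b = b2 - Q"
      using eq nz unfolding r_def by (auto simp: field_simps)
    define h where "h = g - r *s (a *s e1 + b *s e2)"
    have h_eq: "h = 0 *s e0 + P *s e1 + Q *s e2 + (a ^ 2) *s e3 + (2 * a * b) *s e4 + (b ^ 2) *s e5"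
    proof -
      have ab2: "a2 = P + r * a" "b2 = Q + r * b" using r by (simp_all add: algebra_simps)
      show ?thesis unfolding h_def g ab2 by (simp add: vec_eq_iff algebra_simps)
    qed
    have h_osc: "h \<in> ?osc"
      unfolding h_def by (intro vec.span_diff vec.span_scale vec.span_base) auto
    have h_\<Omega>: "h \<in> ?\<Omega>"
      unfolding cospace_iff h_eq
      by (intro exI[of _ 0] exI[of _ "a ^ 2"] exI[of _ "2 * a * b"] exI[of _ "b ^ 2"]) (simp add: P_def Q_def)
    have h_span: "h \<notin> vec.span {e0}"
    proof
      assume "h \<in> vec.span {e0}"
      then obtain k where "h = k *s e0" unfolding span1 by blast
      then have "0 *s e0 + P *s e1 + Q *s e2 + (a ^ 2) *s e3 + (2 * a * b) *s e4 + (b ^ 2) *s e5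
        = k *s e0 + 0 *s e1 + 0 *s e2 + 0 *s e3 + 0 *s e4 + 0 *s e5" using h_eq by simp
      from coeffs_eq[OF this] nz show False by simp
    qed
    have "vec.independent {h, e0}"
      using e0_nz h_span by (intro vec.independent_insertI) (auto simp: vec.independent_empty)
    moreover have "h \<noteq> e0" using h_span vec.span_base by blast
    ultimately have dim2: "vec.dim (vec.span {e0, h}) = 2"
      by (simp add: vec.dim_eq_card_independent insert_commute)
    have "?osc \<inter> ?\<Omega> = vec.span {e0, h}"
    proof
      show "vec.span {e0, h} \<subseteq> ?osc \<inter> ?\<Omega>"
        using h_osc h_\<Omega> by (intro vec.span_minimal sub) (auto simp: cospace_def intro: vec.span_base)
      show "?osc \<inter> ?\<Omega> \<subseteq> vec.span {e0, h}"
      proof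
        fix x assume "x \<in> ?osc \<inter> ?\<Omega>"
        from meet[OF this] obtain k l m where klm: "x = k *s e0 + l *s (a *s e1 + b *s e2) + m *s g"
          "l * a + m * (a2 - P) = 0" "l * b + m * (b2 - Q) = 0" by blast
        have "(l + m * r) * a = 0" using klm(2) r(1) by algebra
        moreover have "(l + m * r) * b = 0" using klm(3) r(2) by algebra
        ultimately have "l + m * r = 0" using nz by (metis mult_eq_0_iff)
        then have "l = - m * r" by algebra
        with klm(1) have "x = k *s e0 + m *s h" unfolding h_def by (simp add: vec_eq_iff algebra_simps)
        then show "x \<in> vec.span {e0, h}" unfolding span2 by blast
      qed
    qed
    then show "proj_space 1 (?osc \<inter> ?\<Omega>)" using dim2 by (simp add: proj_space_def)
  qed
qed

section \<open>Bases of the osculating space adapted to a three-space\<close>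

lemma osc_span_dim: "vec.dim (vec.span (set [e0, e1, e2, e3, e4, e5])) = 6"
  using vec.dim_span_eq_card_independent[OF independent] distinct_card[OF distinct] by simp

text \<open>The difference lies in \<Omega> and in the tangent plane, so it is a multiple of
  \<open>e0\<close>; having no component along \<open>e0\<close>, it vanishes.\<close>

lemma complement_unique:
  assumes "vec.subspace \<Omega>" "\<Omega> \<inter> vec.span {e0, e1, e2} = vec.span {e0}"
    and "z + a *s e1 + b *s e2 \<in> \<Omega>" "z + a' *s e1 + b' *s e2 \<in> \<Omega>"
  shows "a = a' \<and> b = b'"
proof -
  have "(z + a *s e1 + b *s e2) - (z + a' *s e1 + b' *s e2) \<in> \<Omega>"
    using assms by (intro vec.subspace_diff)
  moreover have eq: "(z + a *s e1 + b *s e2) - (z + a' *s e1 + b' *s e2) = 0 *s e0 + (a - a') *s e1 + (b - b') *s e2"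
    by (simp add: vec_eq_iff algebra_simps)
  ultimately have "0 *s e0 + (a - a') *s e1 + (b - b') *s e2 \<in> \<Omega> \<inter> vec.span {e0, e1, e2}"
    unfolding span3 Int_iff by metis
  then have "0 *s e0 + (a - a') *s e1 + (b - b') *s e2 \<in> vec.span {e0}" using assms(2) by blast
  then obtain k where "0 *s e0 + (a - a') *s e1 + (b - b') *s e2 = k *s e0" unfolding span1 by blast
  then have "0 *s e0 + (a - a') *s e1 + (b - b') *s e2 + 0 *s e3 + 0 *s e4 + 0 *s e5
     = k *s e0 + 0 *s e1 + 0 *s e2 + 0 *s e3 + 0 *s e4 + 0 *s e5" by simp
  from coeffs_eq[OF this] show ?thesis by simp
qed

text \<open>A spanning family of \<Omega> at the indices 0 to 3, completed by \<open>e1\<close> at 4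
  and \<open>e2\<close> at 5. The last two coordinates of a vector are what separates it from
  \<Omega>.\<close>

definition adapted where
  "adapted w k = (if k < (4::nat) then w k else if k = 4 then e1 else e2)" for w :: "nat \<Rightarrow> complex ^ 'n"

lemma adapted_sum: "(\<Sum>k<6. c k *s adapted w k) = (\<Sum>k<4. c k *s w k) + c 4 *s e1 + c 5 *s e2"
proof -
  have "{..<6::nat} = insert 5 (insert 4 {..<4})" by auto
  then show ?thesis by (simp add: adapted_def add.assoc add.commute)
qed

text \<open>In a vanishing combination the tangential part lies in \<Omega>, so its coefficients are
  zero by \<open>complement_unique\<close>; the remaining four vectors span dimension 4 and are
  therefore independent.\<close>

lemma adapted_independent:
  assumes \<Omega>: "\<Omega> = vec.span (w ` {..<4})" "vec.dim \<Omega> = 4" "\<Omega> \<inter> vec.span {e0, e1, e2} = vec.span {e0}"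
  shows "inj_on (adapted w) {..<6} \<and> vec.independent (adapted w ` {..<6})"
  unfolding independent_family_iff[OF finite_lessThan] adapted_sum
proof safe
  fix c and i :: nat
  assume c: "(\<Sum>k<4. c k *s w k) + c 4 *s e1 + c 5 *s e2 = 0" and i: "i < 6"
  have s\<Omega>: "(\<Sum>k<4. c k *s w k) \<in> \<Omega>"
    unfolding \<Omega>(1) by (intro vec.span_sum vec.span_scale vec.span_base) auto
  have "0 + 0 *s e1 + 0 *s e2 \<in> \<Omega>" unfolding \<Omega>(1) by (simp add: vec.span_zero)
  moreover have "0 + (- c 4) *s e1 + (- c 5) *s e2 = (\<Sum>k<4. c k *s w k)"
    using c by (simp add: vec_eq_iff algebra_simps add_eq_0_iff)
  then have "0 + (- c 4) *s e1 + (- c 5) *s e2 \<in> \<Omega>" using s\<Omega> by metis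
  ultimately have "0 = - c 4 \<and> 0 = - c 5"
    using \<Omega> by (intro complement_unique[of \<Omega> 0]) auto
  then have c45: "c 4 = 0" "c 5 = 0" by auto
  have card: "4 \<le> card (w ` {..<4})"
    using vec.dim_le_card[of \<Omega> "w ` {..<4}"] \<Omega> by simp
  then have "card (w ` {..<4}) = card {..<4::nat}"
    using card_image_le[of "{..<4}" w] by simp
  then have "inj_on w {..<4}" by (intro eq_card_imp_inj_on) auto
  moreover have "vec.independent (w ` {..<4})"
    using card \<Omega> \<open>card (w ` {..<4}) = _\<close>
    by (intro vec.card_le_dim_spanning[of _ \<Omega>]) (auto intro: vec.span_base)
  ultimately have "\<forall>k\<in>{..<4}. c k = 0"
    using independent_family_iff[of "{..<4}" w] c c45 by auto
  moreover have "i < 4 \<or> i = 4 \<or> i = 5" using i by linarith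
  ultimately show "c i = 0" using c45 by auto
qed

text \<open>Six independent vectors inside a space of dimension 6 span it.\<close>

lemma adapted_spans:
  assumes \<Omega>: "\<Omega> = vec.span (w ` {..<4})" "vec.dim \<Omega> = 4" "\<Omega> \<inter> vec.span {e0, e1, e2} = vec.span {e0}"
    and sub: "\<Omega> \<subseteq> vec.span (set [e0, e1, e2, e3, e4, e5])" and z: "z \<in> vec.span (set [e0, e1, e2, e3, e4, e5])"
  shows "\<exists>c. z = (\<Sum>k<6. c k *s adapted w k)"
proof -
  note ind = adapted_independent[OF \<Omega>]
  have "vec.span (set [e0, e1, e2, e3, e4, e5]) \<subseteq> vec.span (adapted w ` {..<6})"
  proof (rule vec.card_ge_dim_independent)
    show "adapted w ` {..<6} \<subseteq> vec.span (set [e0, e1, e2, e3, e4, e5])"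
      using sub unfolding \<Omega>(1) by (auto simp: adapted_def intro: vec.span_base)
    show "vec.dim (vec.span (set [e0, e1, e2, e3, e4, e5])) \<le> card (adapted w ` {..<6})"
      unfolding osc_span_dim using ind by (simp add: card_image)
  qed (use ind in simp)
  with z have "z \<in> vec.span (adapted w ` {..<6})" by blast
  then obtain u where "z = (\<Sum>x\<in>adapted w ` {..<6}. u x *s x)"
    by (auto simp: vec.span_finite)
  also have "\<dots> = (\<Sum>k<6. u (adapted w k) *s adapted w k)"
    using ind by (simp add: sum.reindex)
  finally show ?thesis by (intro exI[of _ "\<lambda>k. u (adapted w k)"])
qed

text \<open>One inclusion holds by the assumed memberships, the other because both spaces have
  dimension 4.\<close>

lemma cospace_eqI:
  assumes "vec.subspace \<Omega>" "vec.dim \<Omega> = 4" "e0 \<in> \<Omega>"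
    and "e3 + p1 *s e1 + q1 *s e2 \<in> \<Omega>" "e4 + p2 *s e1 + q2 *s e2 \<in> \<Omega>" "e5 + p3 *s e1 + q3 *s e2 \<in> \<Omega>"
  shows "\<Omega> = cospace p1 q1 p2 q2 p3 q3"
proof
  show "cospace p1 q1 p2 q2 p3 q3 \<subseteq> \<Omega>"
    unfolding cospace_def using assms by (intro vec.span_minimal) auto
  show "\<Omega> \<subseteq> cospace p1 q1 p2 q2 p3 q3"
    unfolding cospace_def using assms cospace_basis[of p1 q1 p2 q2 p3 q3]
    by (intro vec.card_ge_dim_independent) auto
qed

end

section \<open>Holomorphic dependence of coordinates\<close>

lemma holo2_det:
  fixes M :: "complex \<times> complex \<Rightarrow> complex ^ 'n ^ 'n"
  assumes "\<And>i j. holo2_on (\<lambda>q. M q $ i $ j) V"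
  shows "holo2_on (\<lambda>q. det (M q)) V"
  unfolding det_def by (intro holo2_sum holo2_mult holo2_prod holo2_const assms)

text \<open>Cramer's rule, after completing the family to a basis by constant vectors.\<close>

lemma holo2_coordinates:
  fixes v :: "'i \<Rightarrow> complex \<times> complex \<Rightarrow> complex ^ 'n"
  assumes V: "open V" and I: "finite I" and v: "\<And>k. k \<in> I \<Longrightarrow> vholo2_on (v k) V" and b: "vholo2_on b V"
    and p: "p \<in> V" and ind: "inj_on (\<lambda>k. v k p) I" "vec.independent ((\<lambda>k. v k p) ` I)"
    and eq: "\<And>q. q \<in> V \<Longrightarrow> b q = (\<Sum>k\<in>I. s k q *s v k q)"
  obtains N where "open N" "p \<in> N" "N \<subseteq> V" "\<And>k. k \<in> I \<Longrightarrow> holo2_on (s k) N"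
proof -
  let ?v = "\<lambda>k. v k p"
  let ?B = "vec.extend_basis (?v ` I)"
  have B: "?v ` I \<subseteq> ?B" "vec.independent ?B" "vec.span ?B = UNIV"
    by (rule vec.extend_basis_superset[OF ind(2)] vec.independent_extend_basis[OF ind(2)]
        vec.span_extend_basis[OF ind(2)])+
  have "card ?B = CARD('n)" using B vec_dim_card vec.dim_span_eq_card_independent by metis
  moreover have "finite ?B" using B(2) vec.finiteI_independent by blast
  ultimately obtain g where g: "bij_betw g (UNIV :: 'n set) ?B"
    by (metis finite_class.finite_UNIV finite_same_card_bij)
  \<comment> \<open>Columns in \<open>J\<close> carry the moving vectors of the family, via
    \<kappa>; the others keep the constant vectors added at \<open>p\<close>.\<close>
  define J where "J = {j. g j \<in> ?v ` I}"
  define \<kappa> where "\<kappa> j = the_inv_into I ?v (g j)" for j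
  have bij: "bij_betw \<kappa> J I"
  proof -
    have "bij_betw g J (?v ` I)"
      using g B(1) unfolding J_def bij_betw_def by (auto intro: inj_on_subset simp: image_iff) (metis imageE imageI subsetD)
    moreover have "bij_betw (the_inv_into I ?v) (?v ` I) I"
      using ind(1) by (simp add: bij_betw_the_inv_into inj_on_imp_bij_betw)
    ultimately show ?thesis unfolding \<kappa>_def[abs_def] using bij_betw_trans[of g J] by (simp add: o_def)
  qed
  define col where "col q j = (if j \<in> J then v (\<kappa> j) q else g j)" for q j
  define M where "M q = (\<chi> i j. col q j $ i)" for q
  define x where "x q = (\<chi> j. if j \<in> J then s (\<kappa> j) q else 0)" for q
  have colM: "column j (M q) = col q j" for j q by (simp add: column_def M_def vec_eq_iff)
  have col_p: "col p j = g j" for j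
    using f_the_inv_into_f[OF ind(1)] by (auto simp: col_def J_def \<kappa>_def)
  have "inj_on g UNIV \<and> vec.independent (g ` UNIV)" using g B(2) by (simp add: bij_betw_def)
  then have "\<exists>M'. M' ** M p = mat 1"
    unfolding matrix_left_invertible_independent_columns colM col_p independent_family_iff[OF finite_class.finite_UNIV]
    by blast
  then have det_p: "det (M p) \<noteq> 0" using invertible_left_inverse invertible_det_nz by blast
  have Mh: "holo2_on (\<lambda>q. M q $ i $ j) V" for i j
  proof (cases "j \<in> J")
    case True
    then have "vholo2_on (v (\<kappa> j)) V" using bij v by (auto simp: bij_betw_def)
    then show ?thesis using True by (simp add: M_def col_def vholo2_on_def)
  qed (simp add: M_def col_def holo2_const)
  have dh: "holo2_on (\<lambda>q. det (M q)) V" by (rule holo2_det[OF Mh])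
  \<comment> \<open>The completed family remains a basis where the determinant does not vanish, an
    open condition that holds at \<open>p\<close>.\<close>
  define N where "N = V \<inter> (\<lambda>q. det (M q)) -` (- {0})"
  have "open N" unfolding N_def
    by (intro continuous_open_preimage holo2_continuous[OF dh] V) auto
  have solve: "M q *v x q = b q" if "q \<in> V" for q
  proof -
    have "M q *v x q = (\<Sum>j\<in>UNIV. x q $ j *s col q j)" by (simp add: matrix_mult_sum colM)
    also have "\<dots> = (\<Sum>j\<in>J. s (\<kappa> j) q *s v (\<kappa> j) q)"
      by (intro sum.mono_neutral_cong_right) (auto simp: x_def col_def)
    also have "\<dots> = (\<Sum>k\<in>I. s k q *s v k q)" by (rule sum.reindex_bij_betw[OF bij])
    finally show ?thesis using eq[OF that] by simp
  qed
  show thesis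
  proof (rule that[OF \<open>open N\<close>])
    show "p \<in> N" "N \<subseteq> V" using p det_p by (auto simp: N_def)
    fix k assume "k \<in> I"
    then obtain j where j: "j \<in> J" "\<kappa> j = k" using bij by (metis bij_betw_iff_bijections)
    \<comment> \<open>No regularity of \<open>s\<close> is known in advance; on \<open>N\<close>
      Cramer's rule identifies it with a quotient of holomorphic determinants.\<close>
    let ?d = "\<lambda>q. det (\<chi> i l. if l = j then b q $ i else M q $ i $ l) / det (M q)"
    have sk: "?d q = s k q" if "q \<in> N" for q
    proof -
      have q: "q \<in> V" "det (M q) \<noteq> 0" using that by (auto simp: N_def)
      from solve[OF q(1)] have "x q = (\<chi> k. det (\<chi> i j. if j = k then b q $ i else M q $ i $ j) / det (M q))"
        unfolding cramer[OF q(2)] .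
      then have "x q $ j = ?d q" by simp
      then show ?thesis using j by (simp add: x_def)
    qed
    have "holo2_on ?d N"
    proof (intro holo2_divide holo2_det)
      have NV: "N \<subseteq> V" by (auto simp: N_def)
      have "holo2_on (\<lambda>q. b q $ i) V" for i using b by (simp add: vholo2_on_def)
      note bN = holo2_subset[OF this NV]
      show "holo2_on (\<lambda>q. (\<chi> i l. if l = j then b q $ i else M q $ i $ l) $ i $ l) N" for i l
        by (cases "l = j") (simp_all add: bN holo2_subset[OF Mh NV])
      show "holo2_on (\<lambda>q. M q $ i $ l) N" for i l using Mh NV holo2_subset by blast
    qed (auto simp: N_def)
    with sk \<open>open N\<close> show "holo2_on (s k) N" by (rule holo2_cong)
  qed
qed


subsection \<open>Spatial systems on a general surface\<close>

lemma (in frame6) cospace_subset: "cospace p1 q1 p2 q2 p3 q3 \<subseteq> vec.span (set [e0, e1, e2, e3, e4, e5])"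
  unfolding cospace_def
  by (intro vec.span_minimal vec.subspace_span) (auto intro!: vec.span_add vec.span_scale intro: vec.span_base)

lemma (in frame6) e0_in_cospace: "e0 \<in> cospace p1 q1 p2 q2 p3 q3"
  unfolding cospace_def by (intro vec.span_base) simp

section \<open>Partial derivatives of vector-valued functions\<close>

lemma pdx_nth: "pdx y p $ i = px (\<lambda>q. y q $ i) p"
  by (simp add: pdx_def vderiv_def px_def)

lemma pdu_nth: "pdu y p $ i = pu (\<lambda>q. y q $ i) p"
  by (simp add: pdu_def vderiv_def pu_def)

lemma vholo2_pdx: "open U \<Longrightarrow> vholo2_on y U \<Longrightarrow> vholo2_on (pdx y) U"
  unfolding vholo2_on_def pdx_nth by (simp add: holo2_px)

lemma vholo2_pdu: "open U \<Longrightarrow> vholo2_on y U \<Longrightarrow> vholo2_on (pdu y) U"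
  unfolding vholo2_on_def pdu_nth by (simp add: holo2_pu)

lemma vholo2_add: "vholo2_on f U \<Longrightarrow> vholo2_on g U \<Longrightarrow> vholo2_on (\<lambda>p. f p + g p) U"
  by (simp add: vholo2_on_def holo2_add)

lemma vholo2_scale: "holo2_on c U \<Longrightarrow> vholo2_on f U \<Longrightarrow> vholo2_on (\<lambda>p. c p *s f p) U"
  by (simp add: vholo2_on_def holo2_mult)

lemma vholo2_subset: "vholo2_on f U \<Longrightarrow> V \<subseteq> U \<Longrightarrow> vholo2_on f V"
  unfolding vholo2_on_def using holo2_subset by blast

locale surface =
  fixes y :: "complex \<times> complex \<Rightarrow> complex ^ 'n" and U :: "(complex \<times> complex) set"
  assumes U: "open U" and general: "general_surface y U"
begin

lemma y: "vholo2_on y U"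
  using general by (simp add: general_surface_def)

lemma frame: "p \<in> U \<Longrightarrow> frame6 (y p) (pdx y p) (pdu y p) (pdx (pdx y) p) (pdu (pdx y) p) (pdu (pdu y) p)"
  using general unfolding frame6_def general_surface_def osc2_list_def by blast

definition cosp where
  "cosp p = frame6.cospace (y p) (pdx y p) (pdu y p) (pdx (pdx y) p) (pdu (pdx y) p) (pdu (pdu y) p)"

text \<open>The chain rule, applied again to the partial derivatives of \<open>y\<close>; symmetry
  of the mixed ones merges two terms into the one with factor 2.\<close>

lemma curve_derivs:
  assumes \<gamma>: "curve_on U T \<gamma>" and t: "t \<in> T"
  defines "dx \<equiv> deriv (\<lambda>s. fst (\<gamma> s))" and "du \<equiv> deriv (\<lambda>s. snd (\<gamma> s))"
  shows "vderiv (\<lambda>s. y (\<gamma> s)) t = dx t *s pdx y (\<gamma> t) + du t *s pdu y (\<gamma> t)"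
    and "vderiv (vderiv (\<lambda>s. y (\<gamma> s))) t = deriv dx t *s pdx y (\<gamma> t) + deriv du t *s pdu y (\<gamma> t) +
      (dx t ^ 2) *s pdx (pdx y) (\<gamma> t) + (2 * dx t * du t) *s pdu (pdx y) (\<gamma> t) + (du t ^ 2) *s pdu (pdu y) (\<gamma> t)"
proof -
  have T: "open T" "(\<lambda>s. fst (\<gamma> s)) holomorphic_on T" "(\<lambda>s. snd (\<gamma> s)) holomorphic_on T"
    and inU: "\<And>s. s \<in> T \<Longrightarrow> \<gamma> s \<in> U" using \<gamma> by (auto simp: curve_on_def)
  have d1: "((\<lambda>s. fst (\<gamma> s)) has_field_derivative dx s) (at s)"
    and d2: "((\<lambda>s. snd (\<gamma> s)) has_field_derivative du s) (at s)" if "s \<in> T" for s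
    unfolding dx_def du_def using that T by (auto intro: holomorphic_derivI)
  have dd1: "(dx has_field_derivative deriv dx t) (at t)" and dd2: "(du has_field_derivative deriv du t) (at t)"
    unfolding dx_def du_def using t T by (auto intro!: holomorphic_derivI[of _ T] holomorphic_deriv)
  have chain: "((\<lambda>s. F (\<gamma> s)) has_field_derivative px F (\<gamma> s) * dx s + pu F (\<gamma> s) * du s) (at s)"
    if "holo2_on F U" "s \<in> T" for F s
    using that inU d1 d2 by (intro holo2_chain[OF U]) auto
  have yi: "holo2_on (\<lambda>q. y q $ i) U" for i using y by (simp add: vholo2_on_def)
  have first: "vderiv (\<lambda>s. y (\<gamma> s)) s = dx s *s pdx y (\<gamma> s) + du s *s pdu y (\<gamma> s)" if "s \<in> T" for s
    using DERIV_imp_deriv[OF chain[OF yi that]]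
    by (simp add: vec_eq_iff vderiv_def pdx_nth pdu_nth mult.commute)
  then show "vderiv (\<lambda>s. y (\<gamma> s)) t = dx t *s pdx y (\<gamma> t) + du t *s pdu y (\<gamma> t)" using t by simp
  show "vderiv (vderiv (\<lambda>s. y (\<gamma> s))) t = deriv dx t *s pdx y (\<gamma> t) + deriv du t *s pdu y (\<gamma> t) +
      (dx t ^ 2) *s pdx (pdx y) (\<gamma> t) + (2 * dx t * du t) *s pdu (pdx y) (\<gamma> t) + (du t ^ 2) *s pdu (pdu y) (\<gamma> t)"
    unfolding vec_eq_iff
  proof
    fix i
    let ?f = "\<lambda>q. y q $ i"
    have comm: "pu (px ?f) (\<gamma> t) = px (pu ?f) (\<gamma> t)" by (rule pu_px_commute[OF U yi inU[OF t]])
    have "((\<lambda>s. px ?f (\<gamma> s) * dx s + pu ?f (\<gamma> s) * du s) has_field_derivative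
        ((px (px ?f) (\<gamma> t) * dx t + pu (px ?f) (\<gamma> t) * du t) * dx t + deriv dx t * px ?f (\<gamma> t)) +
        ((px (pu ?f) (\<gamma> t) * dx t + pu (pu ?f) (\<gamma> t) * du t) * du t + deriv du t * pu ?f (\<gamma> t))) (at t)"
      by (intro DERIV_add DERIV_mult chain holo2_px holo2_pu U yi t dd1 dd2)
    then have "((\<lambda>s. vderiv (\<lambda>s. y (\<gamma> s)) s $ i) has_field_derivative
        ((px (px ?f) (\<gamma> t) * dx t + pu (px ?f) (\<gamma> t) * du t) * dx t + deriv dx t * px ?f (\<gamma> t)) +
        ((px (pu ?f) (\<gamma> t) * dx t + pu (pu ?f) (\<gamma> t) * du t) * du t + deriv du t * pu ?f (\<gamma> t))) (at t)"
      by (rule has_field_derivative_transform_within_open[OF _ T(1) t])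
         (simp add: first pdx_nth pdu_nth mult.commute)
    from DERIV_imp_deriv[OF this]
    show "vderiv (vderiv (\<lambda>s. y (\<gamma> s))) t $ i = (deriv dx t *s pdx y (\<gamma> t) + deriv du t *s pdu y (\<gamma> t) +
      (dx t ^ 2) *s pdx (pdx y) (\<gamma> t) + (2 * dx t * du t) *s pdu (pdx y) (\<gamma> t) + (du t ^ 2) *s pdu (pdu y) (\<gamma> t)) $ i"
      by (simp add: vderiv_def[of "vderiv _"] pdx_nth pdu_nth comm power2_eq_square algebra_simps)
  qed
qed

lemma osc_plane_meets_iff:
  assumes \<gamma>: "curve_on U T \<gamma>" and t: "t \<in> T"
    and \<Omega>: "\<Omega> (\<gamma> t) = cosp (\<gamma> t) (p1 (\<gamma> t)) (q1 (\<gamma> t)) (p2 (\<gamma> t)) (q2 (\<gamma> t)) (p3 (\<gamma> t)) (q3 (\<gamma> t))"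
  shows "proj_space 1 (osc_plane y \<gamma> t \<inter> \<Omega> (\<gamma> t)) \<longleftrightarrow>
    ode_at q1 (\<lambda>p. 2 * q2 p - p1 p) (\<lambda>p. q3 p - 2 * p2 p) (\<lambda>p. - p3 p) \<gamma> t"
proof -
  have "\<gamma> t \<in> U" and nz: "velocity \<gamma> t \<noteq> (0, 0)" using \<gamma> t by (auto simp: curve_on_def)
  then interpret frame6 "y (\<gamma> t)" "pdx y (\<gamma> t)" "pdu y (\<gamma> t)" "pdx (pdx y) (\<gamma> t)" "pdu (pdx y) (\<gamma> t)"
     "pdu (pdu y) (\<gamma> t)" using frame by blast
  show ?thesis
    unfolding \<Omega> cosp_def osc_plane_def curve_derivs(1)[OF \<gamma> t]
    by (subst osc_cospace_dim[OF _ curve_derivs(2)[OF \<gamma> t]])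
      (use nz in \<open>auto simp: velocity_def ode_at_def Let_def\<close>)
qed

text \<open>Locally the frame of \<Omega> together with \<open>y_x\<close> and \<open>y_u\<close> is
  a basis of the osculating space, and \<open>holo2_coordinates\<close> makes the coordinates of
  \<open>z\<close> holomorphic. The pair of coefficients is unique at every point, so local
  solutions agree where they overlap.\<close>

lemma complement_coeffs:
  assumes \<Omega>: "space_congruence y U \<Omega>" and z: "vholo2_on z U" "\<And>p. p \<in> U \<Longrightarrow> z p \<in> osc2_space y p"
  obtains \<alpha> \<beta> where "holo2_on \<alpha> U" "holo2_on \<beta> U"
    "\<And>p. p \<in> U \<Longrightarrow> z p + \<alpha> p *s pdx y p + \<beta> p *s pdu y p \<in> \<Omega> p"
proof -
  define good where "good p c \<longleftrightarrow> z p + fst c *s pdx y p + snd c *s pdu y p \<in> \<Omega> p" for p and c :: "complex \<times> complex"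
  have \<Omega>p: "vec.subspace (\<Omega> p)" "vec.dim (\<Omega> p) = 4" "\<Omega> p \<subseteq> osc2_space y p"
     "\<Omega> p \<inter> vec.span {y p, pdx y p, pdu y p} = vec.span {y p}" if "p \<in> U" for p
    using \<Omega> that by (auto simp: space_congruence_def proj_space_def tangent_plane_def)
  have unique: "c = c'" if "p \<in> U" "good p c" "good p c'" for p c c'
    using frame6.complement_unique[OF frame[OF that(1)] \<Omega>p(1,4)[OF that(1)]] that(2,3)
    unfolding good_def by (metis prod_eq_iff)
  have local: "\<exists>N c. open N \<and> p \<in> N \<and> holo2_on (\<lambda>q. fst (c q)) N \<and> holo2_on (\<lambda>q. snd (c q)) N \<and> (\<forall>q\<in>N. q \<in> U \<and> good q (c q))"
    if p: "p \<in> U" for p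
  proof -
    have "\<exists>V w. open V \<and> p \<in> V \<and> V \<subseteq> U \<and> (\<forall>k<4. vholo2_on (w k) V) \<and>
        (\<forall>q\<in>V. \<Omega> q = vec.span ((\<lambda>k::nat. w k q) ` {..<4}))"
      using \<Omega> p unfolding space_congruence_def by blast
    then obtain V w where V: "open V" "p \<in> V" "V \<subseteq> U" and w: "\<And>k. k < 4 \<Longrightarrow> vholo2_on (w k) V"
      and span: "\<And>q. q \<in> V \<Longrightarrow> \<Omega> q = vec.span ((\<lambda>k::nat. w k q) ` {..<4})" by blast
    define v where "v k q = (if k < 4 then w k q else if k = 4 then pdx y q else pdu y q)" for k :: nat and q
    have v_eq: "v k q = frame6.adapted (pdx y q) (pdu y q) (\<lambda>k. w k q) k" if "q \<in> V" for k q
      using frame6.adapted_def[OF frame, of q] V that by (auto simp: v_def)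
    have "\<exists>c. z q = (\<Sum>k<6. c k *s v k q)" if q: "q \<in> V" for q
    proof -
      have qU: "q \<in> U" using q V by blast
      have "\<Omega> q \<subseteq> vec.span (set [y q, pdx y q, pdu y q, pdx (pdx y) q, pdu (pdx y) q, pdu (pdu y) q])"
        "z q \<in> vec.span (set [y q, pdx y q, pdu y q, pdx (pdx y) q, pdu (pdx y) q, pdu (pdu y) q])"
        using \<Omega>p(3)[OF qU] z(2)[OF qU] by (simp_all only: osc2_space_def osc2_list_def)
      from frame6.adapted_spans[OF frame[OF qU] span[OF q] \<Omega>p(2,4)[OF qU] this]
      show ?thesis by (simp only: v_eq[OF q])
    qed
    then obtain s where s: "\<And>q. q \<in> V \<Longrightarrow> z q = (\<Sum>k<6. s q k *s v k q)" by metis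
    have ind: "inj_on (\<lambda>k. v k p) {..<6}" "vec.independent ((\<lambda>k. v k p) ` {..<6})"
      using frame6.adapted_independent[OF frame[OF p] span[OF V(2)] \<Omega>p(2,4)[OF p]]
      unfolding v_eq[OF V(2)] by auto
    have vv: "vholo2_on (v k) V" for k
    proof -
      consider "k < 4" | "k = 4" | "k > 4" by linarith
      then show ?thesis
        using w vholo2_subset[OF vholo2_pdx[OF U y] V(3)] vholo2_subset[OF vholo2_pdu[OF U y] V(3)]
        unfolding v_def[abs_def] by cases auto
    qed
    obtain N where N: "open N" "p \<in> N" "N \<subseteq> V" "\<And>k. k \<in> {..<6} \<Longrightarrow> holo2_on (\<lambda>q. s q k) N"
      by (rule holo2_coordinates[OF V(1) finite_lessThan vv vholo2_subset[OF z(1) V(3)] V(2) ind, of "\<lambda>k q. s q k"])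
         (use s in auto)
    \<comment> \<open>Subtracting the coordinates along \<open>y_x\<close> and \<open>y_u\<close>
      leaves the part of \<open>z\<close> in \<Omega>; hence the signs.\<close>
    have "good q (- s q 4, - s q 5)" if "q \<in> N" for q
    proof -
      have q: "q \<in> V" using that N by blast
      have "z q = (\<Sum>k<4. s q k *s w k q) + s q 4 *s pdx y q + s q 5 *s pdu y q"
        using s[OF q] frame6.adapted_sum[OF frame, of q "s q" "\<lambda>k. w k q"] q V(3) by (auto simp: v_eq[OF q])
      then have "z q + (- s q 4) *s pdx y q + (- s q 5) *s pdu y q = (\<Sum>k<4. s q k *s w k q)"
        by (simp add: vec_eq_iff)
      also have "\<dots> \<in> \<Omega> q"
        unfolding span[OF q] by (intro vec.span_sum vec.span_scale vec.span_base) auto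
      finally show ?thesis by (simp add: good_def)
    qed
    then show ?thesis
      using N V(3) by (intro exI[of _ N] exI[of _ "\<lambda>q. (- s q 4, - s q 5)"]) (auto intro!: holo2_minus)
  qed
  \<comment> \<open>By uniqueness the chosen value is that of every local solution, so
    \<open>c\<close> inherits holomorphy.\<close>
  define c where "c p = (SOME c. good p c)" for p
  have c: "good p (c p)" if "p \<in> U" for p
    using local[OF that] unfolding c_def by (metis someI_ex)
  have hol: "\<exists>N. p \<in> N \<and> holo2_on (\<lambda>q. fst (c q)) N" "\<exists>N. p \<in> N \<and> holo2_on (\<lambda>q. snd (c q)) N" if p: "p \<in> U" for p
  proof -
    obtain N c' where N: "open N" "p \<in> N" "holo2_on (\<lambda>q. fst (c' q)) N" "holo2_on (\<lambda>q. snd (c' q)) N"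
      "\<And>q. q \<in> N \<Longrightarrow> q \<in> U \<and> good q (c' q)" using local[OF p] by blast
    have "c' q = c q" if "q \<in> N" for q using unique c N(5)[OF that] by blast
    then show "\<exists>N. p \<in> N \<and> holo2_on (\<lambda>q. fst (c q)) N" "\<exists>N. p \<in> N \<and> holo2_on (\<lambda>q. snd (c q)) N"
      using N(2) holo2_cong[OF _ N(1,3), of "\<lambda>q. fst (c q)"] holo2_cong[OF _ N(1,4), of "\<lambda>q. snd (c q)"] by auto
  qed
  show thesis
    by (rule that[of "\<lambda>p. fst (c p)" "\<lambda>p. snd (c p)"])
       (use hol c in \<open>auto intro!: holo2_local simp: good_def\<close>)
qed

lemma spatial_system_represented:
  assumes "spatial_system y U \<Gamma>"
  shows "\<exists>A B C D. holo2_on A U \<and> holo2_on B U \<and> holo2_on C U \<and> holo2_on D U \<and> represents U A B C D \<Gamma>"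
proof -
  obtain \<Omega> where \<Gamma>: "two_param_system U \<Gamma>" and \<Omega>: "space_congruence y U \<Omega>"
    and meets: "\<And>T \<gamma> t. (T, \<gamma>) \<in> \<Gamma> \<Longrightarrow> t \<in> T \<Longrightarrow> proj_space 1 (osc_plane y \<gamma> t \<inter> \<Omega> (\<gamma> t))"
    using assms unfolding spatial_system_def by blast
  have in_osc: "pdx (pdx y) p \<in> osc2_space y p" "pdu (pdx y) p \<in> osc2_space y p" "pdu (pdu y) p \<in> osc2_space y p" for p
    unfolding osc2_space_def osc2_list_def by (auto intro: vec.span_base)
  obtain p1 q1 where 1: "holo2_on p1 U" "holo2_on q1 U"
      "\<And>p. p \<in> U \<Longrightarrow> pdx (pdx y) p + p1 p *s pdx y p + q1 p *s pdu y p \<in> \<Omega> p"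
    using complement_coeffs[OF \<Omega> vholo2_pdx[OF U vholo2_pdx[OF U y]] in_osc(1)] by blast
  obtain p2 q2 where 2: "holo2_on p2 U" "holo2_on q2 U"
      "\<And>p. p \<in> U \<Longrightarrow> pdu (pdx y) p + p2 p *s pdx y p + q2 p *s pdu y p \<in> \<Omega> p"
    using complement_coeffs[OF \<Omega> vholo2_pdu[OF U vholo2_pdx[OF U y]] in_osc(2)] by blast
  obtain p3 q3 where 3: "holo2_on p3 U" "holo2_on q3 U"
      "\<And>p. p \<in> U \<Longrightarrow> pdu (pdu y) p + p3 p *s pdx y p + q3 p *s pdu y p \<in> \<Omega> p"
    using complement_coeffs[OF \<Omega> vholo2_pdu[OF U vholo2_pdu[OF U y]] in_osc(3)] by blast
  have \<Omega>_eq: "\<Omega> p = cosp p (p1 p) (q1 p) (p2 p) (q2 p) (p3 p) (q3 p)" if p: "p \<in> U" for p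
    unfolding cosp_def using \<Omega> p 1(3)[OF p] 2(3)[OF p] 3(3)[OF p]
    by (intro frame6.cospace_eqI[OF frame[OF p]]) (auto simp: space_congruence_def proj_space_def)
  let ?B = "\<lambda>p. 2 * q2 p - p1 p" and ?C = "\<lambda>p. q3 p - 2 * p2 p" and ?D = "\<lambda>p. - p3 p"
  have h: "holo2_on q1 U" "holo2_on ?B U" "holo2_on ?C U" "holo2_on ?D U"
    using 1 2 3 by (auto intro!: holo2_diff holo2_mult holo2_minus holo2_const)
  have "integral_curve q1 ?B ?C ?D T \<gamma>" if mem: "(T, \<gamma>) \<in> \<Gamma>" for T \<gamma>
    unfolding integral_curve_iff
  proof
    fix t assume t: "t \<in> T"
    have \<gamma>: "curve_on U T \<gamma>" using \<Gamma> mem by (auto simp: two_param_system_def)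
    then have "\<gamma> t \<in> U" using t by (auto simp: curve_on_def)
    from osc_plane_meets_iff[where \<Omega> = \<Omega> and ?p1.0 = p1 and ?q1.0 = q1 and ?p2.0 = p2
        and ?q2.0 = q2 and ?p3.0 = p3 and ?q3.0 = q3, OF \<gamma> t \<Omega>_eq[OF this]] meets[OF mem t]
    show "ode_at q1 ?B ?C ?D \<gamma> t" by blast
  qed
  from represents_if_integral[OF U h \<Gamma> this] h show ?thesis by blast
qed

lemma equation_spatial_system:
  assumes h: "holo2_on A U" "holo2_on B U" "holo2_on C U" "holo2_on D U"
  shows "\<exists>\<Gamma>. spatial_system y U \<Gamma> \<and> represents U A B C D \<Gamma>"
proof -
  let ?\<Gamma> = "{(T, \<gamma>). curve_on U T \<gamma> \<and> integral_curve A B C D T \<gamma>}"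
  have \<Gamma>: "two_param_system U ?\<Gamma>" by (rule integral_curves_two_param[OF U h])
  \<comment> \<open>Solves \<open>A = q1\<close>, \<open>B = 2 q2 - p1\<close>,
    \<open>C = q3 - 2 p2\<close>, \<open>D = - p3\<close> under \<open>p1 = p2 = 0\<close>; the
    arguments alternate between \<open>p\<close> and \<open>q\<close>.\<close>
  define \<Omega> where "\<Omega> p = cosp p 0 (A p) 0 (B p / 2) (- D p) (C p)" for p
  \<comment> \<open>A holomorphic frame on all of \<open>U\<close>, so the frame condition holds
    with \<open>V = U\<close>; the zero summands keep the shape of the spanning set in
    \<open>cospace\<close>.\<close>
  define w where "w k p = [y p, pdx (pdx y) p + 0 *s pdx y p + A p *s pdu y p,
      pdu (pdx y) p + 0 *s pdx y p + (B p / 2) *s pdu y p,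
      pdu (pdu y) p + (- D p) *s pdx y p + C p *s pdu y p] ! k" for k p
  have w: "vholo2_on (w k) U" if "k < 4" for k
  proof -
    have "vholo2_on (\<lambda>p. pdx (pdx y) p + 0 *s pdx y p + A p *s pdu y p) U"
      "vholo2_on (\<lambda>p. pdu (pdx y) p + 0 *s pdx y p + (B p / 2) *s pdu y p) U"
      "vholo2_on (\<lambda>p. pdu (pdu y) p + (- D p) *s pdx y p + C p *s pdu y p) U"
      by (intro vholo2_add vholo2_scale vholo2_pdx vholo2_pdu U y h holo2_const holo2_divide holo2_minus; simp)+
    moreover have "k = 0 \<or> k = 1 \<or> k = 2 \<or> k = 3" using that by auto
    ultimately show ?thesis using y by (elim disjE) (simp_all add: w_def[abs_def])
  qed
  have span: "\<Omega> p = vec.span ((\<lambda>k. w k p) ` {..<4})" if "p \<in> U" for p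
  proof -
    have "(\<lambda>k. w k p) ` {..<4} = {w 0 p, w 1 p, w 2 p, w 3 p}"
      by (auto simp: numeral_eq_Suc lessThan_Suc)
    then show ?thesis
      unfolding \<Omega>_def cosp_def frame6.cospace_def[OF frame[OF that]] by (simp add: w_def)
  qed
  have "space_congruence y U \<Omega>"
    unfolding space_congruence_def
  proof (intro conjI ballI)
    fix p assume p: "p \<in> U"
    note fr = frame[OF p]
    show "proj_space 3 (\<Omega> p)" "y p \<in> \<Omega> p" "\<Omega> p \<inter> tangent_plane y p = vec.span {y p}" "\<Omega> p \<subseteq> osc2_space y p"
      unfolding \<Omega>_def cosp_def tangent_plane_def osc2_space_def osc2_list_def
      by (rule frame6.proj_space_cospace[OF fr] frame6.e0_in_cospace[OF fr] frame6.cospace_tangent[OF fr]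
          frame6.cospace_subset[OF fr])+
    show "\<exists>V w. open V \<and> p \<in> V \<and> V \<subseteq> U \<and> (\<forall>k<4. vholo2_on (w k) V) \<and>
        (\<forall>q\<in>V. \<Omega> q = vec.span ((\<lambda>k::nat. w k q) ` {..<4}))"
      using U p w span by (intro exI[of _ U] exI[of _ w]) auto
  qed
  moreover have "proj_space 1 (osc_plane y \<gamma> t \<inter> \<Omega> (\<gamma> t))"
    if "curve_on U T \<gamma>" "integral_curve A B C D T \<gamma>" "t \<in> T" for T \<gamma> t
  proof -
    have "ode_at A B C D \<gamma> t" using that by (simp add: integral_curve_iff)
    then show ?thesis
      using osc_plane_meets_iff[OF that(1,3), where \<Omega> = \<Omega> and ?p1.0 = "\<lambda>_. 0" and ?q1.0 = A and ?p2.0 = "\<lambda>_. 0"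
        and ?q2.0 = "\<lambda>p. B p / 2" and ?p3.0 = "\<lambda>p. - D p" and ?q3.0 = C]
      by (simp add: \<Omega>_def)
  qed
  ultimately have "spatial_system y U ?\<Gamma>" using \<Gamma> unfolding spatial_system_def by blast
  moreover have "represents U A B C D ?\<Gamma>" by (rule represents_if_integral[OF U h \<Gamma>]) blast
  ultimately show ?thesis by blast
qed

end

theorem theorem2p13:
  fixes y :: "complex \<times> complex \<Rightarrow> complex ^ 'n" and U :: "(complex \<times> complex) set"
  assumes "open U" and "general_surface y U"
  shows "(\<forall>\<Gamma>. spatial_system y U \<Gamma> \<longrightarrow>
            (\<exists>A B C D. holo2_on A U \<and> holo2_on B U \<and> holo2_on C U \<and> holo2_on D U \<and>
               represents U A B C D \<Gamma>)) \<and>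
         (\<forall>A B C D. holo2_on A U \<and> holo2_on B U \<and> holo2_on C U \<and> holo2_on D U \<longrightarrow>
            (\<exists>\<Gamma>. spatial_system y U \<Gamma> \<and> represents U A B C D \<Gamma>))"
proof -
  interpret surface y U using assms by unfold_locales
  show ?thesis using spatial_system_represented equation_spatial_system by blast
qed

end
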